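(* Let $M,M'\subset\mathbb C^{n+1}$ be connected real-analytic hypersurfaces and $U$ an open neighborhood of $M$ in $\mathbb C^{n+1}$. Assume that $M$ is holomorphically nondegenerate and let $H\colon U\to\mathbb C^{n+1}$ be a holomorphic mapping such that $H(M)\subset M'$. The following are equivalent: (i) There is an open subset $V\subset U$ with $M\subset V$ and $H(V)\subset M'$. (iv) There exist $p\in M$ and an open neighborhood $W\subset U$ of $p$ in $\mathbb C^{n+1}$ such that $H(M\cap W)$ is contained in the Segre variety of $M'$ at $H(p)$. (v) The rank of $H$ is $\le n$ at every $p\in M$.
   Context: Hypersurface means real hypersurface. The rank of $H$ at $p$ is the complex rank of its holomorphic Jacobian matrix at $p$. A connected real-analytic hypersurface $M\subset \mathbb C^{n+1}$ is holomorphically nondegenerate if there is no point of $M$ at which there is a germ of a nontrivial (not identically zero) holomorphic $(1,0)$-vector field $\sum_j a_j(Z)\,\partial/\partial Z_j$ ($a_j$ holomorphic) tangent to $M$. If a real-analytic hypersurface $M'\subset\mathbb C^{n+1}$ is defined near $p_0'\in M'$ by a real-analytic equation $\rho'(Z',\bar Z')=0$ ($\rho'$ real-valued, $d\rho'\ne0$), the Segre variety of $M'$ at a point $p'$ sufficiently close to $p'_0$ is the complex hypersurface given near $p_0'$ by the holomorphic equation $\rho'(Z',\bar p')=0$, where $\rho'(Z',\zeta')$ is the complexification of $\rho'$. *)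

theory Defs
  imports "HOL-Analysis.Analysis"
begin

text \<open>Throughout, \<open>\<complex>\<^sup>k\<close> is \<open>complex ^ 'k\<close> with \<open>k = CARD('k)\<close>, which is also a real Euclidean
  space whose \<open>Basis\<close> consists of the vectors \<open>axis j 1\<close> and \<open>axis j \<i>\<close>; thus the real coordinates
  below are the real and imaginary parts of the complex ones.\<close>

section \<open>Real-analytic functions\<close>

text \<open>Multi-indices are the (extensional) functions \<open>Basis \<rightarrow> nat\<close>; \<open>has_sum\<close> is unordered, hence
  absolute, convergence.\<close>

definition real_analytic_at :: "('a::euclidean_space \<Rightarrow> real) \<Rightarrow> 'a \<Rightarrow> bool" where
  "real_analytic_at f p \<longleftrightarrow>
     (\<exists>r>0. \<exists>c :: ('a \<Rightarrow> nat) \<Rightarrow> real. \<forall>x\<in>ball p r.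
        ((\<lambda>\<alpha>. c \<alpha> * (\<Prod>b\<in>Basis. ((x - p) \<bullet> b) ^ \<alpha> b)) has_sum f x) (Basis \<rightarrow>\<^sub>E UNIV))"

section \<open>Holomorphic functions and maps of several variables\<close>

text \<open>Only meant for open \<open>S\<close>: complex differentiability at every point.\<close>

definition hol_fun_on :: "(complex ^ 'k \<Rightarrow> complex) \<Rightarrow> (complex ^ 'k) set \<Rightarrow> bool" where
  "hol_fun_on f S \<longleftrightarrow>
     (\<forall>p\<in>S. \<exists>c :: complex ^ 'k. (f has_derivative (\<lambda>v. \<Sum>j\<in>UNIV. c $ j * v $ j)) (at p))"

definition hol_map_on :: "(complex ^ 'k \<Rightarrow> complex ^ 'm) \<Rightarrow> (complex ^ 'k) set \<Rightarrow> bool" where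
  "hol_map_on F S \<longleftrightarrow> (\<forall>i. hol_fun_on (\<lambda>z. F z $ i) S)"

text \<open>The \<open>(i, j)\<close> entry of the library's \<open>jacobian F (at p)\<close> is the value of the derivative of
  \<open>F\<close> on \<open>axis j 1\<close>, component \<open>i\<close>. For holomorphic \<open>F\<close> this is \<open>\<partial>F\<^sub>i/\<partial>Z\<^sub>j\<close>, so that the matrix is
  the holomorphic Jacobian matrix; \<open>rank\<close> is then its rank over the field \<open>complex\<close>.\<close>

definition hol_rank :: "(complex ^ 'k \<Rightarrow> complex ^ 'm) \<Rightarrow> complex ^ 'k \<Rightarrow> nat" where
  "hol_rank F p = rank (jacobian F (at p) :: complex ^ 'k ^ 'm)"

section \<open>Real-analytic hypersurfaces\<close>

definition defining_function ::
    "(complex ^ 'k) set \<Rightarrow> (complex ^ 'k) set \<Rightarrow> (complex ^ 'k \<Rightarrow> real) \<Rightarrow> bool" where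
  "defining_function M \<Omega> \<rho> \<longleftrightarrow>
     open \<Omega> \<and>
     (\<forall>z\<in>\<Omega>. real_analytic_at \<rho> z) \<and>
     (\<forall>z\<in>\<Omega>. frechet_derivative \<rho> (at z) \<noteq> (\<lambda>_. 0)) \<and>
     M \<inter> \<Omega> = {z \<in> \<Omega>. \<rho> z = 0}"

text \<open>Hypersurfaces are embedded, nonempty, and not assumed closed in \<open>\<complex>\<^sup>k\<close>.\<close>

definition real_analytic_hypersurface :: "(complex ^ 'k) set \<Rightarrow> bool" where
  "real_analytic_hypersurface M \<longleftrightarrow>
     M \<noteq> {} \<and> (\<forall>p\<in>M. \<exists>\<Omega> \<rho>. p \<in> \<Omega> \<and> defining_function M \<Omega> \<rho>)"

section \<open>Holomorphic nondegeneracy\<close>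

text \<open>\<open>\<partial>\<rho>/\<partial>Z\<^sub>j = (\<partial>\<rho>/\<partial>x\<^sub>j - \<i> \<partial>\<rho>/\<partial>y\<^sub>j) / 2\<close>, where \<open>Z\<^sub>j = x\<^sub>j + \<i> y\<^sub>j\<close>.\<close>

definition wirtinger :: "(complex ^ 'k \<Rightarrow> real) \<Rightarrow> 'k \<Rightarrow> complex ^ 'k \<Rightarrow> complex" where
  "wirtinger \<rho> j z =
     (of_real (frechet_derivative \<rho> (at z) (axis j 1))
        - \<i> * of_real (frechet_derivative \<rho> (at z) (axis j \<i>))) / 2"

text \<open>The \<open>(1,0)\<close>-vector \<open>\<Sum>\<^sub>j v\<^sub>j \<partial>/\<partial>Z\<^sub>j\<close> at \<open>q \<in> M\<close> is tangent to \<open>M\<close> iff it annihilates a local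
  defining function; the condition does not depend on the choice of the latter.\<close>

definition tangent_10 :: "(complex ^ 'k) set \<Rightarrow> complex ^ 'k \<Rightarrow> complex ^ 'k \<Rightarrow> bool" where
  "tangent_10 M q v \<longleftrightarrow>
     (\<exists>\<Omega> \<rho>. q \<in> \<Omega> \<and> defining_function M \<Omega> \<rho> \<and> (\<Sum>j\<in>UNIV. v $ j * wirtinger \<rho> j q) = 0)"

text \<open>Nontriviality is that of the germ of \<open>a\<close> at \<open>p\<close>, hence the quantification over \<open>N'\<close>.\<close>

definition holomorphically_nondegenerate :: "(complex ^ 'k) set \<Rightarrow> bool" where
  "holomorphically_nondegenerate M \<longleftrightarrow>
     \<not> (\<exists>p\<in>M. \<exists>N a. open N \<and> p \<in> N \<and> hol_map_on a N \<and>
           (\<forall>N'. open N' \<and> p \<in> N' \<longrightarrow> (\<exists>z\<in>N \<inter> N'. a z \<noteq> 0)) \<and>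
           (\<forall>q\<in>M \<inter> N. tangent_10 M q (a q)))"

section \<open>Segre varieties\<close>

definition conj_vec :: "complex ^ 'k \<Rightarrow> complex ^ 'k" where
  "conj_vec z = (\<chi> j. cnj (z $ j))"

text \<open>The identification of \<open>\<complex>\<^sup>k \<times> \<complex>\<^sup>k\<close> with \<open>\<complex>\<^sup>2\<^sup>k\<close>.\<close>

definition join_vec :: "complex ^ 'k \<Rightarrow> complex ^ 'k \<Rightarrow> complex ^ ('k + 'k)" where
  "join_vec z \<zeta> = (\<chi> s. case s of Inl j \<Rightarrow> z $ j | Inr j \<Rightarrow> \<zeta> $ j)"

text \<open>\<open>R\<close> is a holomorphic function of \<open>(Z, \<zeta>) \<in> \<Omega> \<times> conj \<Omega>\<close> with \<open>R(Z, conj Z) = \<rho>(Z)\<close>. As \<open>\<Omega>\<close> is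
  connected and \<open>{(Z, conj Z)}\<close> is maximally totally real, \<open>R\<close> is unique there.\<close>

definition complexification ::
    "(complex ^ 'k) set \<Rightarrow> (complex ^ 'k \<Rightarrow> real) \<Rightarrow> (complex ^ ('k + 'k) \<Rightarrow> complex) \<Rightarrow> bool" where
  "complexification \<Omega> \<rho> R \<longleftrightarrow>
     open \<Omega> \<and> connected \<Omega> \<and>
     hol_fun_on R {join_vec z (conj_vec w) | z w. z \<in> \<Omega> \<and> w \<in> \<Omega>} \<and>
     (\<forall>z\<in>\<Omega>. R (join_vec z (conj_vec z)) = of_real (\<rho> z))"

text \<open>\<open>S\<close> is a representative, in a neighborhood \<open>\<Omega>\<close> of the point \<open>p \<in> M\<close>, of the Segre variety of
  \<open>M\<close> at \<open>p\<close>. The defining equation is taken near the point \<open>p\<close> itself. Representatives depend on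
  \<open>\<Omega>\<close> and \<open>\<rho>\<close> but all have the same germ at \<open>p\<close>, and this is the germ of a complex hypersurface.\<close>

definition is_segre_variety ::
    "(complex ^ 'k) set \<Rightarrow> complex ^ 'k \<Rightarrow> (complex ^ 'k) set \<Rightarrow> bool" where
  "is_segre_variety M p S \<longleftrightarrow>
     (\<exists>\<Omega> \<rho> R. p \<in> \<Omega> \<and> defining_function M \<Omega> \<rho> \<and> complexification \<Omega> \<rho> R \<and>
        S = {z \<in> \<Omega>. R (join_vec z (conj_vec p)) = 0})"

end

theory Submission
  imports Defs "HOL-Complex_Analysis.Complex_Analysis"
begin

text \<open>Let \<open>J\<close> be the Jacobian determinant of \<open>H\<close>. A holomorphic function vanishing on \<open>M\<close> near a point
  vanishes near that point, so (v) says that \<open>J = 0\<close> near \<open>M\<close>, and by connectedness it suffices to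
  have \<open>J = 0\<close> near one point of \<open>M\<close>.

  (i) implies (iv): if \<open>\<rho>' \<circ> H = 0\<close> near \<open>p\<close>, then the complexified identity
  \<open>\<rho>'(H(Z), conj H(conj \<zeta>)) = 0\<close> at \<open>\<zeta> = conj p\<close> says that \<open>H(Z)\<close> lies in the Segre variety at \<open>H(p)\<close>.

  (iv) implies (v): \<open>g(Z) = \<rho>'(Z, conj H(p))\<close> is holomorphic with \<open>dg \<noteq> 0\<close> near \<open>H(p)\<close>, and \<open>g \<circ> H\<close>
  vanishes on \<open>M\<close>, hence near \<open>p\<close>; so \<open>dg \<circ> dH = 0\<close> there and \<open>J = 0\<close>.

  (v) implies (i): as \<open>J = 0\<close>, near suitable points of \<open>M\<close> there is a holomorphic vector field
  \<open>X \<noteq> 0\<close> with \<open>dH(X) = 0\<close>. By nondegeneracy \<open>X\<close> is transverse to \<open>M\<close> somewhere; there the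
  fibres of \<open>H\<close> meet \<open>M\<close>, so \<open>H\<close> maps an open set into \<open>H(M)\<close>, and \<open>\<rho>' \<circ> H = 0\<close> spreads by
  analyticity.\<close>

section \<open>Holomorphic functions of several variables\<close>

lemma norm_vector_scalar_mult: "norm (c *s v) = norm c * norm v"
  for c :: complex and v :: "complex ^ 'k"
  by (simp add: norm_vec_def norm_mult L2_set_right_distrib)

lemma has_derivative_vecI:
  fixes f :: "'a::real_normed_vector \<Rightarrow> 'b::euclidean_space ^ 'k"
  assumes "\<And>i. ((\<lambda>x. f x $ i) has_derivative (\<lambda>v. f' v $ i)) (at x within S)"
  shows "(f has_derivative f') (at x within S)"
  unfolding has_derivative_componentwise_within[of f]
  using assms by (auto simp: Basis_vec_def inner_axis intro!: has_derivative_inner_left)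

text \<open>For holomorphic \<open>f\<close> the derivative is complex linear, so its value in the
  real direction \<open>axis j 1\<close> is the complex partial derivative.\<close>

definition pd :: "'k \<Rightarrow> (complex ^ 'k \<Rightarrow> complex) \<Rightarrow> complex ^ 'k \<Rightarrow> complex" where
  "pd j f z = frechet_derivative f (at z) (axis j 1)"

lemma sum_mult_axis: "(\<Sum>j\<in>UNIV. c j * axis i a $ j) = c i * (a::'a::comm_semiring_1)"
  unfolding axis_def by (subst sum.remove[of _ i]) auto

lemma pd_eqI:
  assumes "(f has_derivative (\<lambda>v. \<Sum>j\<in>UNIV. c j * v $ j)) (at z)"
  shows "pd j f z = c j"
  unfolding pd_def frechet_derivative_at[OF assms, symmetric] by (simp add: sum_mult_axis)

lemma hol_fun_has_derivative:
  assumes "hol_fun_on f S" "z \<in> S"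
  shows "(f has_derivative (\<lambda>v. \<Sum>j\<in>UNIV. pd j f z * v $ j)) (at z)"
proof -
  obtain c :: "complex ^ 'a" where c: "(f has_derivative (\<lambda>v. \<Sum>j\<in>UNIV. c $ j * v $ j)) (at z)"
    using assms unfolding hol_fun_on_def by blast
  show ?thesis using c by (simp add: pd_eqI[OF c])
qed

lemma hol_fun_onI:
  assumes "\<And>z. z \<in> S \<Longrightarrow> (f has_derivative (\<lambda>v. \<Sum>j\<in>UNIV. c z j * v $ j)) (at z)"
  shows "hol_fun_on f S"
  unfolding hol_fun_on_def
proof
  fix z assume "z \<in> S"
  then show "\<exists>c::complex^'a. (f has_derivative (\<lambda>v. \<Sum>j\<in>UNIV. c $ j * v $ j)) (at z)"
    using assms[of z] by (intro exI[of _ "\<chi> j. c z j"]) simp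
qed

lemma hol_fun_on_subset: "hol_fun_on f S \<Longrightarrow> T \<subseteq> S \<Longrightarrow> hol_fun_on f T"
  unfolding hol_fun_on_def by blast

lemma hol_map_on_subset: "hol_map_on F S \<Longrightarrow> T \<subseteq> S \<Longrightarrow> hol_map_on F T"
  unfolding hol_map_on_def using hol_fun_on_subset by blast

lemma hol_fun_on_continuous: "hol_fun_on f S \<Longrightarrow> continuous_on S f"
  by (meson continuous_at_imp_continuous_on has_derivative_continuous hol_fun_has_derivative)

section \<open>Algebra and composition of holomorphic functions\<close>

lemma hol_fun_on_const: "hol_fun_on (\<lambda>_. a) S"
  by (rule hol_fun_onI[of _ _ "\<lambda>_ _. 0"]) simp

lemma hol_fun_on_nth: "hol_fun_on (\<lambda>z. z $ i) S"
proof (rule hol_fun_onI)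
  fix z :: "complex ^ 'a"
  have "(\<lambda>v::complex ^ 'a. v $ i) = (\<lambda>v. \<Sum>j\<in>UNIV. (if j = i then 1 else 0) * v $ j)"
    by (auto simp: if_distrib[of "\<lambda>x. x * _"] cong: if_cong)
  moreover have "((\<lambda>v::complex ^ 'a. v $ i) has_derivative (\<lambda>v. v $ i)) (at z)"
    by (rule bounded_linear_imp_has_derivative[OF bounded_linear_vec_nth])
  ultimately show "((\<lambda>v::complex ^ 'a. v $ i) has_derivative
      (\<lambda>v. \<Sum>j\<in>UNIV. (if j = i then 1 else 0) * v $ j)) (at z)"
    by simp
qed

lemma hol_fun_on_add:
  assumes "hol_fun_on f S" "hol_fun_on g S"
  shows "hol_fun_on (\<lambda>z. f z + g z) S"
proof (rule hol_fun_onI)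
  fix z assume z: "z \<in> S"
  show "((\<lambda>z. f z + g z) has_derivative (\<lambda>v. \<Sum>j\<in>UNIV. (pd j f z + pd j g z) * v $ j)) (at z)"
    by (rule has_derivative_eq_rhs[OF has_derivative_add[OF hol_fun_has_derivative[OF assms(1) z]
            hol_fun_has_derivative[OF assms(2) z]]])
       (simp add: distrib_right sum.distrib)
qed

lemma hol_fun_on_mult:
  assumes "hol_fun_on f S" "hol_fun_on g S"
  shows "hol_fun_on (\<lambda>z. f z * g z) S"
proof (rule hol_fun_onI)
  fix z assume z: "z \<in> S"
  show "((\<lambda>z. f z * g z) has_derivative
      (\<lambda>v. \<Sum>j\<in>UNIV. (f z * pd j g z + pd j f z * g z) * v $ j)) (at z)"
    by (rule has_derivative_eq_rhs[OF has_derivative_mult[OF hol_fun_has_derivative[OF assms(1) z]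
            hol_fun_has_derivative[OF assms(2) z]]])
       (auto simp: fun_eq_iff algebra_simps sum.distrib sum_distrib_left)
qed

lemma hol_fun_on_diff:
  assumes "hol_fun_on f S" "hol_fun_on g S"
  shows "hol_fun_on (\<lambda>z. f z - g z) S"
  using hol_fun_on_add[OF assms(1) hol_fun_on_mult[OF hol_fun_on_const[of "-1"] assms(2)]] by simp

lemma hol_fun_on_sum:
  "(\<And>i. i \<in> I \<Longrightarrow> hol_fun_on (f i) S) \<Longrightarrow> hol_fun_on (\<lambda>z. \<Sum>i\<in>I. f i z) S"
  by (induction I rule: infinite_finite_induct) (auto intro: hol_fun_on_const hol_fun_on_add)

lemma hol_fun_on_prod:
  "(\<And>i. i \<in> I \<Longrightarrow> hol_fun_on (f i) S) \<Longrightarrow> hol_fun_on (\<lambda>z. \<Prod>i\<in>I. f i z) S"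
  by (induction I rule: infinite_finite_induct) (auto intro: hol_fun_on_const hol_fun_on_mult)

lemma hol_fun_on_power: "hol_fun_on f S \<Longrightarrow> hol_fun_on (\<lambda>z. f z ^ n) S"
  by (induction n) (auto intro: hol_fun_on_const hol_fun_on_mult)

lemma hol_fun_on_det:
  fixes A :: "complex ^ 'k \<Rightarrow> complex ^ 'n ^ 'n"
  assumes "\<And>i j. hol_fun_on (\<lambda>z. A z $ i $ j) S"
  shows "hol_fun_on (\<lambda>z. det (A z)) S"
  unfolding det_def by (intro hol_fun_on_sum hol_fun_on_mult hol_fun_on_const hol_fun_on_prod assms)

lemma hol_fun_on_cong:
  assumes "open S" "hol_fun_on f S" "\<And>z. z \<in> S \<Longrightarrow> f z = g z"
  shows "hol_fun_on g S"
proof (rule hol_fun_onI)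
  fix z assume z: "z \<in> S"
  show "(g has_derivative (\<lambda>v. \<Sum>j\<in>UNIV. pd j f z * v $ j)) (at z)"
    using has_derivative_transform_within_open[OF hol_fun_has_derivative[OF assms(2) z] assms(1) z]
      assms(3) by blast
qed

lemma hol_map_has_derivative:
  assumes "hol_map_on F S" "z \<in> S"
  shows "(F has_derivative (\<lambda>v. jacobian F (at z) *v v)) (at z)"
    and "jacobian F (at z) $ i $ j = pd j (\<lambda>z. F z $ i) z"
proof -
  define A where "A = (\<chi> i j. pd j (\<lambda>z. F z $ i) z)"
  have D: "(F has_derivative (\<lambda>v. A *v v)) (at z)"
    using assms unfolding hol_map_on_def
    by (intro has_derivative_vecI)
       (auto simp: A_def matrix_vector_mult_def intro!: hol_fun_has_derivative)
  have J: "jacobian F (at z) = A"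
    unfolding jacobian_def frechet_derivative_at[OF D, symmetric]
    by (simp add: matrix_def vec_eq_iff matrix_vector_mult_def sum_mult_axis)
  show "(F has_derivative (\<lambda>v. jacobian F (at z) *v v)) (at z)"
    "jacobian F (at z) $ i $ j = pd j (\<lambda>z. F z $ i) z"
    using D J by (auto simp: A_def)
qed

lemma hol_map_on_continuous: "hol_map_on F S \<Longrightarrow> continuous_on S F"
  by (meson continuous_at_imp_continuous_on has_derivative_continuous hol_map_has_derivative(1))

lemma hol_fun_comp_deriv:
  fixes F :: "complex ^ 'k \<Rightarrow> complex ^ 'm"
  assumes "hol_fun_on g T" "hol_map_on F S" "z \<in> S" "F z \<in> T"
  shows "((\<lambda>z. g (F z)) has_derivative
     (\<lambda>v. \<Sum>j\<in>UNIV. (\<Sum>i\<in>UNIV. pd i g (F z) * jacobian F (at z) $ i $ j) * v $ j)) (at z)"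
  by (rule has_derivative_eq_rhs[OF has_derivative_compose[OF hol_map_has_derivative(1)[OF assms(2,3)]
        hol_fun_has_derivative[OF assms(1,4)]]])
     (auto simp: fun_eq_iff matrix_vector_mult_def sum_distrib_left sum_distrib_right mult_ac
       intro: sum.swap)

lemma hol_fun_on_comp:
  assumes "hol_fun_on g T" "hol_map_on F S" "F ` S \<subseteq> T"
  shows "hol_fun_on (\<lambda>z. g (F z)) S"
  by (rule hol_fun_onI, rule hol_fun_comp_deriv[OF assms(1,2)]) (use assms(3) in auto)

section \<open>Restriction to holomorphic curves and complex lines\<close>

lemma hol_fun_comp_curve:
  fixes \<gamma> :: "complex \<Rightarrow> complex ^ 'k"
  assumes "hol_fun_on f S" "\<gamma> t \<in> S"
    and "\<And>j. ((\<lambda>t. \<gamma> t $ j) has_field_derivative d j) (at t)"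
  shows "((\<lambda>t. f (\<gamma> t)) has_field_derivative (\<Sum>j\<in>UNIV. pd j f (\<gamma> t) * d j)) (at t)"
proof -
  have "(\<gamma> has_derivative (\<lambda>h. \<chi> j. d j * h)) (at t)"
    using assms(3) by (intro has_derivative_vecI) (simp add: has_field_derivative_def)
  from has_derivative_compose[OF this hol_fun_has_derivative[OF assms(1,2)]]
  show ?thesis
    unfolding has_field_derivative_def
    by (rule has_derivative_eq_rhs) (auto simp: fun_eq_iff sum_distrib_left mult_ac)
qed

lemma hol_fun_line_deriv:
  assumes "hol_fun_on f S" "z + t *s v \<in> S"
  shows "((\<lambda>t. f (z + t *s v)) has_field_derivative (\<Sum>j\<in>UNIV. pd j f (z + t *s v) * v $ j)) (at t)"
  by (rule hol_fun_comp_curve[where \<gamma> = "\<lambda>t. z + t *s v", OF assms]) (auto intro!: derivative_eq_intros)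

lemma continuous_on_line: "continuous_on T (\<lambda>t. z + t *s (v :: complex ^ 'k))"
  by (intro continuous_on_add continuous_on_const) 
     (auto simp: vector_scalar_mult_def intro!: continuous_intros)

lemma hol_fun_line_holomorphic:
  assumes "hol_fun_on f S" "\<And>t. t \<in> T \<Longrightarrow> z + t *s v \<in> S"
  shows "(\<lambda>t. f (z + t *s v)) holomorphic_on T"
  unfolding holomorphic_on_def field_differentiable_def
  using hol_fun_line_deriv[OF assms(1)] assms(2) has_field_derivative_at_within by blast

text \<open>Cauchy's inequality on discs of radius \<open>r / 4\<close> bounds the second derivative
  on \<open>cball 0 (r / 2)\<close> by \<open>2 * B / (r / 4)\<^sup>2\<close>, whence the constant
  32. Only \<open>r\<close> and \<open>B\<close> enter, so the estimate is uniform over families of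
  lines.\<close>

lemma holomorphic_linear_approx:
  assumes "\<phi> holomorphic_on ball 0 r" "0 < r"
    and B: "\<And>t. t \<in> ball 0 r \<Longrightarrow> norm (\<phi> t) \<le> B"
    and t: "norm t \<le> r / 2"
  shows "norm (\<phi> t - \<phi> 0 - deriv \<phi> 0 * t) \<le> 32 * B / r\<^sup>2 * (norm t)\<^sup>2"
proof -
  have "norm ((deriv ^^ 0) \<phi> t - (\<Sum>i\<le>1. (deriv ^^ i) \<phi> 0 * (t - 0) ^ i / fact i))
      \<le> (32 * B / r\<^sup>2) * norm (t - 0) ^ Suc 1 / fact 1"
  proof (rule field_Taylor[where S = "cball 0 (r/2)" and f = "\<lambda>i. (deriv ^^ i) \<phi>" and n = 1
        and w = 0 and z = t and B = "32 * B / r\<^sup>2"])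
    fix i :: nat and x :: complex
    assume x: "x \<in> cball 0 (r / 2)"
    have "(deriv ^^ i) \<phi> holomorphic_on ball 0 r"
      by (rule holomorphic_higher_deriv[OF assms(1)]) simp
    moreover have "x \<in> ball 0 r" using x \<open>0 < r\<close> by simp
    ultimately have "((deriv ^^ i) \<phi> has_field_derivative deriv ((deriv ^^ i) \<phi>) x) (at x)"
      by (intro holomorphic_derivI[of _ "ball 0 r"]) auto
    then show "((deriv ^^ i) \<phi> has_field_derivative (deriv ^^ Suc i) \<phi> x) (at x within cball 0 (r / 2))"
      by (simp add: has_field_derivative_at_within)
  next
    fix x :: complex
    assume x: "x \<in> cball 0 (r / 2)"
    have sub: "cball x (r / 4) \<subseteq> ball 0 r"
    proof
      fix y assume "y \<in> cball x (r / 4)"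
      moreover have "norm y \<le> norm x + dist x y"
        by (metis dist_0_norm dist_triangle)
      ultimately show "y \<in> ball 0 r" using x \<open>0 < r\<close> by simp
    qed
    have "norm ((deriv ^^ 2) \<phi> x) \<le> fact 2 * B / (r / 4) ^ 2"
    proof (rule Cauchy_inequality)
      show "\<phi> holomorphic_on ball x (r / 4)"
        by (rule holomorphic_on_subset[OF assms(1) subset_trans[OF ball_subset_cball sub]])
      show "continuous_on (cball x (r / 4)) \<phi>"
        by (rule continuous_on_subset[OF holomorphic_on_imp_continuous_on[OF assms(1)] sub])
      show "norm (\<phi> y) \<le> B" if "norm (x - y) = r / 4" for y
      proof -
        have "y \<in> cball x (r / 4)" using that by (simp add: dist_norm)
        then show ?thesis using sub B by blast
      qed
    qed (use \<open>0 < r\<close> in auto)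
    then show "norm ((deriv ^^ Suc 1) \<phi> x) \<le> 32 * B / r\<^sup>2"
      using \<open>0 < r\<close> by (simp add: numeral_2_eq_2 power2_eq_square field_simps)
  qed (use t \<open>0 < r\<close> in auto)
  then show ?thesis
    by (simp add: diff_diff_add power2_eq_square)
qed

section \<open>Uniform limits and partial derivatives\<close>

text \<open>The one-variable Weierstrass theorem applies on each complex line through
  \<open>z\<close>. Directional derivatives of the limit are limits of complex linear forms, hence
  linear in the direction, and a quadratic remainder bound uniform in the direction gives Frechet
  differentiability.\<close>

lemma hol_fun_on_uniform_limit:
  fixes f :: "'i \<Rightarrow> complex ^ 'k \<Rightarrow> complex"
  assumes "open S" and F: "F \<noteq> bot"
    and hol: "\<forall>\<^sub>F n in F. hol_fun_on (f n) S"
    and lim: "uniform_limit S f g F"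
  shows "hol_fun_on g S"
proof (rule hol_fun_onI)
  fix z assume "z \<in> S"
  then obtain R where "R > 0" and R: "cball z R \<subseteq> S"
    using \<open>open S\<close> open_contains_cball by blast
  define P where "P v = deriv (\<lambda>t. g (z + t *s v)) 0" for v
  have in_S: "z + t *s v \<in> S" if "norm v \<le> 1" "norm t \<le> R" for t v
  proof -
    have "norm (t *s v) \<le> R"
      using mult_mono[OF that(2,1)] \<open>R > 0\<close> by (simp add: norm_vector_scalar_mult)
    then show ?thesis using R by (auto simp: dist_norm)
  qed
  have cont: "continuous_on S g"
    by (rule uniform_limit_theorem[OF eventually_mono[OF hol hol_fun_on_continuous] lim F])
  have P: "((\<lambda>n. \<Sum>j\<in>UNIV. pd j (f n) z * v $ j) \<longlongrightarrow> P v) F"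
    and line: "(\<lambda>t. g (z + t *s v)) holomorphic_on ball 0 R" if v: "norm v \<le> 1" for v
  proof -
    have 1: "\<forall>\<^sub>F n in F. continuous_on (cball 0 R) (\<lambda>t. f n (z + t *s v)) \<and>
       (\<forall>w\<in>ball 0 R. ((\<lambda>t. f n (z + t *s v)) has_field_derivative
          (\<Sum>j\<in>UNIV. pd j (f n) (z + w *s v) * v $ j)) (at w))"
      using hol
    proof eventually_elim
      case (elim n)
      have "(\<lambda>t. f n (z + t *s v)) holomorphic_on cball 0 R"
        by (rule hol_fun_line_holomorphic[OF elim]) (use in_S v in auto)
      then show ?case
        using hol_fun_line_deriv[OF elim] in_S[OF v] holomorphic_on_imp_continuous_on by auto
    qed
    have 2: "uniform_limit (cball 0 R) (\<lambda>n t. f n (z + t *s v)) (\<lambda>t. g (z + t *s v)) F"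
      using lim in_S[OF v] unfolding uniform_limit_iff
      by (auto elim!: eventually_mono)
    obtain g' where g': "\<And>w. w \<in> ball 0 R \<Longrightarrow>
        ((\<lambda>t. g (z + t *s v)) has_field_derivative g' w) (at w) \<and>
        ((\<lambda>n. \<Sum>j\<in>UNIV. pd j (f n) (z + w *s v) * v $ j) \<longlongrightarrow> g' w) F"
      using has_complex_derivative_uniform_limit[OF 1 2 F \<open>R > 0\<close>] by blast
    have "P v = g' 0"
      using g'[of 0] \<open>R > 0\<close> by (auto simp: P_def intro: DERIV_imp_deriv)
    then show "((\<lambda>n. \<Sum>j\<in>UNIV. pd j (f n) z * v $ j) \<longlongrightarrow> P v) F"
      using g'[of 0] \<open>R > 0\<close> by simp
    show "(\<lambda>t. g (z + t *s v)) holomorphic_on ball 0 R"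
      by (rule holomorphic_onI) 
         (use g' in \<open>meson field_differentiable_at_within field_differentiable_def\<close>)
  qed
  have P_lin: "P v = (\<Sum>j\<in>UNIV. P (axis j 1) * v $ j)" if "norm v \<le> 1" for v
  proof (rule tendsto_unique[OF F P[OF that]])
    have "((\<lambda>n. pd j (f n) z) \<longlongrightarrow> P (axis j 1)) F" for j
      using P[of "axis j 1"] by (simp add: sum_mult_axis norm_axis_1)
    then show "((\<lambda>n. \<Sum>j\<in>UNIV. pd j (f n) z * v $ j) \<longlongrightarrow> (\<Sum>j\<in>UNIV. P (axis j 1) * v $ j)) F"
      by (intro tendsto_intros)
  qed
  obtain B where B: "\<And>y. y \<in> cball z R \<Longrightarrow> norm (g y) \<le> B"
    using compact_continuous_image[OF continuous_on_subset[OF cont R] compact_cball]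
    by (meson bounded_iff compact_imp_bounded imageI)
  define C where "C = 32 * B / R\<^sup>2"
  have "C \<ge> 0"
    using order_trans[OF norm_ge_zero B[of z]] \<open>R > 0\<close> by (simp add: C_def)
  \<comment> \<open>Writing \<open>y\<close> as \<open>z + t *s v\<close> with
    \<open>norm v = 1\<close> allows the same \<open>R\<close> and \<open>B\<close> in the
    one-variable estimate for every direction.\<close>
  have quad: "norm (g y - g z - (\<Sum>j\<in>UNIV. P (axis j 1) * (y - z) $ j)) \<le> C * (norm (y - z))\<^sup>2"
    if y: "norm (y - z) \<le> R / 2" for y
  proof (cases "y = z")
    case False
    define t :: complex where "t = of_real (norm (y - z))"
    define v where "v = inverse t *s (y - z)"
    have t0: "t \<noteq> 0" using False by (simp add: t_def)
    have nt: "norm t = norm (y - z)" by (simp add: t_def)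
    have v1: "norm v = 1"
      unfolding v_def norm_vector_scalar_mult using False by (simp add: norm_inverse nt)
    have yv: "z + t *s v = y" using t0 by (simp add: v_def vector_smult_assoc)
    have "norm (g (z + t *s v) - g (z + 0 *s v) - deriv (\<lambda>t. g (z + t *s v)) 0 * t)
        \<le> 32 * B / R\<^sup>2 * (norm t)\<^sup>2"
    proof (rule holomorphic_linear_approx[OF line \<open>R > 0\<close>])
      show "norm (g (z + s *s v)) \<le> B" if "s \<in> ball 0 R" for s
        using that v1 by (intro B) (auto simp: dist_norm norm_vector_scalar_mult)
    qed (use v1 y nt in auto)
    moreover have "deriv (\<lambda>t. g (z + t *s v)) 0 * t = (\<Sum>j\<in>UNIV. P (axis j 1) * (y - z) $ j)"
    proof -
      have "v $ j * t = (y - z) $ j" for j 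
        unfolding v_def vector_smult_component mult.commute[of _ t] mult.assoc[symmetric]
        using t0 by simp
      then show ?thesis
        using P_lin[of v] v1 by (simp add: P_def[symmetric] sum_distrib_right mult.assoc)
    qed
    ultimately show ?thesis by (simp add: yv C_def nt)
  qed simp
  show "(g has_derivative (\<lambda>v. \<Sum>j\<in>UNIV. P (axis j 1) * v $ j)) (at z)"
    unfolding has_derivative_at_alt
  proof (intro conjI allI impI)
    show "bounded_linear (\<lambda>v. \<Sum>j\<in>UNIV. P (axis j 1) * v $ j)"
      by (intro bounded_linear_sum bounded_linear_const_mult bounded_linear_vec_nth)
    fix e :: real assume "e > 0"
    define d where "d = min (R / 2) (e / (C + 1))"
    have "d > 0" using \<open>R > 0\<close> \<open>e > 0\<close> \<open>C \<ge> 0\<close> by (simp add: d_def)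
    moreover have "norm (g y - g z - (\<Sum>j\<in>UNIV. P (axis j 1) * (y - z) $ j)) \<le> e * norm (y - z)"
      if "norm (y - z) < d" for y
    proof -
      have "(C + 1) * norm (y - z) \<le> e"
        using that \<open>C \<ge> 0\<close> by (simp add: d_def field_simps)
      then have "C * norm (y - z) \<le> e"
        using norm_ge_zero[of "y - z"] by (simp add: distrib_right del: norm_ge_zero)
      then have "C * (norm (y - z))\<^sup>2 \<le> e * norm (y - z)"
        by (simp add: power2_eq_square mult_right_mono flip: mult.assoc)
      then show ?thesis using quad[of y] that by (simp add: d_def)
    qed
    ultimately show "\<exists>d>0. \<forall>y. norm (y - z) < d \<longrightarrow>
       norm (g y - g z - (\<Sum>j\<in>UNIV. P (axis j 1) * (y - z) $ j)) \<le> e * norm (y - z)"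
      by blast
  qed
qed

text \<open>Difference quotients in the direction \<open>axis j 1\<close> are holomorphic and, by
  the quadratic estimate, converge uniformly near each point;
  \<open>hol_fun_on_uniform_limit\<close> then applies.\<close>

lemma hol_fun_on_pd:
  assumes "open S" "hol_fun_on f S"
  shows "hol_fun_on (pd j f) S"
proof -
  have "\<exists>T. z0 \<in> T \<and> hol_fun_on (pd j f) T" if z0: "z0 \<in> S" for z0
  proof -
    obtain R where "R > 0" and R: "cball z0 R \<subseteq> S"
      using \<open>open S\<close> z0 open_contains_cball by blast
    obtain B where B: "\<And>y. y \<in> cball z0 R \<Longrightarrow> norm (f y) \<le> B"
      using compact_continuous_image[OF 
          continuous_on_subset[OF hol_fun_on_continuous[OF assms(2)] R] compact_cball]
      by (meson bounded_iff compact_imp_bounded imageI)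
    \<comment> \<open>Half the radius leaves room for \<open>z + h *s e\<close> to stay in
      \<open>cball z0 R\<close>, where \<open>f\<close> is bounded by \<open>B\<close>, as long as
      \<open>norm h < R / 2\<close>.\<close>
    define T where "T = ball z0 (R / 2)"
    define e :: "complex ^ 'a" where "e = axis j 1"
    define C where "C = 32 * B / (R / 2)\<^sup>2"
    have "C \<ge> 0"
      using order_trans[OF norm_ge_zero B[of z0]] \<open>R > 0\<close> by (simp add: C_def)
    have in_ball: "z + h *s e \<in> cball z0 R" if "z \<in> T" "norm h < R / 2" for z h
    proof -
      have "norm (h *s e) < R / 2" using that by (simp add: norm_vector_scalar_mult e_def norm_axis_1)
      then have "norm ((z - z0) + h *s e) \<le> R"
        using that norm_triangle_ineq[of "z - z0" "h *s e"]
        by (simp add: T_def dist_norm norm_minus_commute)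
      then show ?thesis by (simp add: dist_norm norm_minus_commute algebra_simps)
    qed
    have ev: "\<forall>\<^sub>F h in at 0. norm h < r" if "r > 0" for r and h :: complex
      using that by (auto simp: eventually_at intro: exI[of _ r])
    have "hol_fun_on (pd j f) T"
    proof (rule hol_fun_on_uniform_limit)
      show "\<forall>\<^sub>F h in at 0. hol_fun_on (\<lambda>z. inverse h * (f (z + h *s e) - f z)) T"
        using ev[OF half_gt_zero[OF \<open>R > 0\<close>]]
      proof eventually_elim
        case (elim h)
        have "hol_map_on (\<lambda>z. z + h *s e) T"
          unfolding hol_map_on_def by (auto intro!: hol_fun_on_add hol_fun_on_nth hol_fun_on_const)
        then have "hol_fun_on (\<lambda>z. f (z + h *s e)) T"
          by (rule hol_fun_on_comp[OF assms(2)]) (use in_ball elim R in auto)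
        moreover have "hol_fun_on f T"
          by (rule hol_fun_on_subset[OF assms(2)]) (use R \<open>R > 0\<close> in \<open>auto simp: T_def\<close>)
        ultimately show ?case
          by (intro hol_fun_on_mult hol_fun_on_const hol_fun_on_diff)
      qed
      show "uniform_limit T (\<lambda>h z. inverse h * (f (z + h *s e) - f z)) (pd j f) (at 0)"
        unfolding uniform_limit_iff
      proof (intro allI impI)
        fix \<epsilon> :: real assume "\<epsilon> > 0"
        define d where "d = min (R / 4) (\<epsilon> / (C + 1))"
        have "d > 0" using \<open>R > 0\<close> \<open>\<epsilon> > 0\<close> \<open>C \<ge> 0\<close> by (simp add: d_def)
        have "dist (inverse h * (f (z + h *s e) - f z)) (pd j f z) < \<epsilon>"
          if h: "h \<noteq> 0" "norm h < d" and z: "z \<in> T" for h z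
        proof -
          have D: "((\<lambda>t. f (z + t *s e)) has_field_derivative pd j f z) (at 0)"
          proof -
            have "z + 0 *s e \<in> S" using in_ball[OF z, of 0] R \<open>R > 0\<close> by auto
            from hol_fun_line_deriv[OF assms(2) this]
            show ?thesis by (simp add: e_def sum_mult_axis)
          qed
          have "norm (f (z + h *s e) - f (z + 0 *s e) - deriv (\<lambda>t. f (z + t *s e)) 0 * h)
              \<le> 32 * B / (R / 2)\<^sup>2 * (norm h)\<^sup>2"
          proof (rule holomorphic_linear_approx)
            show "(\<lambda>t. f (z + t *s e)) holomorphic_on ball 0 (R / 2)"
              by (rule hol_fun_line_holomorphic[OF assms(2)]) (use in_ball[OF z] R in auto)
            show "norm (f (z + t *s e)) \<le> B" if "t \<in> ball 0 (R / 2)" for t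
              using that in_ball[OF z] by (intro B) auto
          qed (use h \<open>R > 0\<close> in \<open>auto simp: d_def\<close>)
          then have 1: "norm (f (z + h *s e) - f z - pd j f z * h) \<le> C * (norm h)\<^sup>2"
            by (simp add: DERIV_imp_deriv[OF D] C_def)
          have "dist (inverse h * (f (z + h *s e) - f z)) (pd j f z)
              = norm (inverse h * (f (z + h *s e) - f z - pd j f z * h))"
            unfolding dist_norm right_diff_distrib[of "inverse h" _ "pd j f z * h"]
            using h by (simp add: mult.left_commute[of "inverse h"])
          also have "\<dots> \<le> inverse (norm h) * (C * (norm h)\<^sup>2)"
            unfolding norm_mult norm_inverse by (intro mult_left_mono 1) simp
          also have "\<dots> = C * norm h" using h by (simp add: power2_eq_square)
          also have "\<dots> \<le> (C + 1) * norm h" by (intro mult_right_mono) auto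
          also have "\<dots> < \<epsilon>" using h \<open>C \<ge> 0\<close> by (simp add: d_def field_simps)
          finally show ?thesis .
        qed
        then show "\<forall>\<^sub>F h in at 0. \<forall>z\<in>T. dist (inverse h * (f (z + h *s e) - f z)) (pd j f z) < \<epsilon>"
          using \<open>d > 0\<close> by (auto simp: eventually_at intro!: exI[of _ d])
      qed
    qed (auto simp: T_def)
    then show ?thesis using \<open>R > 0\<close> by (intro exI[of _ T]) (auto simp: T_def)
  qed
  then show ?thesis unfolding hol_fun_on_def by blast
qed

section \<open>Complexification\<close>

text \<open>In the coordinates (Z, \<zeta>) this is the product of \<open>\<Omega>\<close> with its
  complex conjugate, the domain occurring in \<open>complexification\<close>.\<close>

definition doubled :: "(complex ^ 'k) set \<Rightarrow> (complex ^ ('k + 'k)) set" where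
  "doubled \<Omega> = {join_vec z (conj_vec w) | z w. z \<in> \<Omega> \<and> w \<in> \<Omega>}"

lemma join_vec_nth [simp]: "join_vec z \<zeta> $ Inl j = z $ j" "join_vec z \<zeta> $ Inr j = \<zeta> $ j"
  by (simp_all add: join_vec_def)

lemma conj_vec_nth [simp]: "conj_vec z $ j = cnj (z $ j)"
  by (simp add: conj_vec_def)

lemma sum_UNIV_Plus:
  "(\<Sum>s\<in>(UNIV :: ('k::finite + 'k) set). f s) = (\<Sum>j\<in>UNIV. f (Inl j)) + (\<Sum>j\<in>UNIV. f (Inr j))"
  by (simp flip: UNIV_Plus_UNIV add: sum.Plus)

lemma continuous_on_conj_vec: "continuous_on S (conj_vec :: complex ^ 'k \<Rightarrow> _)"
  unfolding conj_vec_def by (intro continuous_intros continuous_on_component continuous_on_id)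

lemma continuous_on_join_conj:
  "continuous_on S f \<Longrightarrow> continuous_on S g \<Longrightarrow> continuous_on S (\<lambda>x. join_vec (f x :: complex ^ 'k) (conj_vec (g x)))"
  unfolding join_vec_def
proof (rule continuous_on_vec_lambda)
  fix i :: "'k + 'k"
  assume "continuous_on S f" "continuous_on S g"
  then show "continuous_on S (\<lambda>x. case i of Inl j \<Rightarrow> f x $ j | Inr j \<Rightarrow> conj_vec (g x) $ j)"
    by (cases i) (auto intro!: continuous_intros continuous_on_component)
qed

lemma doubled_mem: "join_vec z (conj_vec w) \<in> doubled \<Omega> \<longleftrightarrow> z \<in> \<Omega> \<and> w \<in> \<Omega>"
proof
  assume "join_vec z (conj_vec w) \<in> doubled \<Omega>"
  then obtain z' w' where eq: "join_vec z (conj_vec w) = join_vec z' (conj_vec w')"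
    and in_\<Omega>: "z' \<in> \<Omega>" "w' \<in> \<Omega>"
    unfolding doubled_def by blast
  have "z $ j = z' $ j" "w $ j = w' $ j" for j
    using arg_cong[OF eq, of "\<lambda>s. s $ Inl j"] arg_cong[OF eq, of "\<lambda>s. s $ Inr j"] by auto
  then have "z = z'" "w = w'" by (simp_all add: vec_eq_iff)
  then show "z \<in> \<Omega> \<and> w \<in> \<Omega>" using in_\<Omega> by simp
qed (auto simp: doubled_def)

lemma open_doubled:
  assumes "open \<Omega>"
  shows "open (doubled \<Omega>)"
proof -
  have "doubled \<Omega> = (\<lambda>s. \<chi> j. s $ Inl j) -` \<Omega> \<inter> (\<lambda>s. conj_vec (\<chi> j. s $ Inr j)) -` \<Omega>"
  proof (intro set_eqI iffI)
    fix s assume "s \<in> (\<lambda>s. \<chi> j. s $ Inl j) -` \<Omega> \<inter> (\<lambda>s. conj_vec (\<chi> j. s $ Inr j)) -` \<Omega>"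
    moreover have "s = join_vec (\<chi> j. s $ Inl j) (conj_vec (conj_vec (\<chi> j. s $ Inr j)))"
      by (auto simp: vec_eq_iff join_vec_def split: sum.split)
    ultimately show "s \<in> doubled \<Omega>" unfolding doubled_def by blast
  qed (auto simp: doubled_def conj_vec_def vec_lambda_eta)
  moreover have "continuous_on UNIV (\<lambda>s::complex ^ ('a + 'a). \<chi> j. s $ Inl j)"
    by (intro continuous_on_vec_lambda continuous_on_component continuous_on_id)
  moreover have "continuous_on UNIV (\<lambda>s::complex ^ ('a + 'a). conj_vec (\<chi> j. s $ Inr j))"
    by (intro continuous_on_compose2[OF continuous_on_conj_vec[of UNIV]]
        continuous_on_vec_lambda continuous_on_component continuous_on_id) auto
  ultimately show ?thesis
    using assms by (auto intro!: open_Int open_vimage)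
qed

lemma sum_norm_nth_le: "(\<Sum>j\<in>UNIV. norm (v $ j)) \<le> real CARD('k) * norm (v :: complex ^ 'k)"
  by (rule order_trans[OF sum_bounded_above[of UNIV _ "norm v"]]) (auto simp: Finite_Cartesian_Product.norm_nth_le)

text \<open>The real coordinate \<open>(x - p) \<bullet> b\<close> extends to the complex affine function \<open>l b\<close> of \<open>(Z, \<zeta>)\<close>, so
  substituting \<open>l b\<close> into the power series of \<open>\<rho>\<close> gives the complexification.\<close>

lemma real_analytic_complexification:
  fixes \<rho> :: "complex ^ 'k \<Rightarrow> real"
  assumes "real_analytic_at \<rho> p"
  obtains r R where "r > 0" "complexification (ball p r) \<rho> R"
proof -
  obtain r c where "r > 0" and c: "\<And>x. x \<in> ball p r \<Longrightarrow>
      ((\<lambda>\<alpha>. c \<alpha> * (\<Prod>b\<in>Basis. ((x - p) \<bullet> b) ^ \<alpha> b)) has_sum \<rho> x) (Basis \<rightarrow>\<^sub>E UNIV)"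
    using assms unfolding real_analytic_at_def by blast
  \<comment> \<open>The point whose real coordinates relative to \<open>p\<close> all equal
    \<epsilon> is then within \<open>r / 2\<close> of \<open>p\<close>, so the series converges
    absolutely there; the radius \<open>r'\<close> keeps every \<open>l b\<close> bounded by
    \<epsilon>.\<close>
  define \<epsilon> where "\<epsilon> = r / (2 * real DIM(complex ^ 'k))"
  define r' where "r' = min r (\<epsilon> / real CARD('k))"
  have pos: "\<epsilon> > 0" "r' > 0"
    using \<open>r > 0\<close> DIM_positive[where 'a = "complex ^ 'k"] by (auto simp: \<epsilon>_def r'_def)
  \<comment> \<open>This is \<open>2 * Re (w * cnj u) = w * cnj u + cnj w * u\<close> with the
    conjugate variable replaced by the independent \<zeta>.\<close>
  define l :: "complex ^ 'k \<Rightarrow> complex ^ ('k + 'k) \<Rightarrow> complex" where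
    "l b s = (\<Sum>j\<in>UNIV. (s $ Inl j - p $ j) * cnj (b $ j) + (s $ Inr j - cnj (p $ j)) * b $ j) * (1/2)"
    for b s
  define T where "T \<alpha> s = of_real (c \<alpha>) * (\<Prod>b\<in>Basis. l b s ^ \<alpha> b)" for \<alpha> s
  define R where "R s = (\<Sum>\<^sub>\<infinity>\<alpha>\<in>Basis \<rightarrow>\<^sub>E UNIV. T \<alpha> s)" for s
  have l_diag: "l b (join_vec z (conj_vec z)) = of_real ((z - p) \<bullet> b)" for b z
  proof -
    have "w * cnj u + cnj w * u = of_real (2 * (w \<bullet> u))" for w u :: complex
      by (simp add: complex_eq_iff inner_complex_def)
    from this[of "(z - p) $ j" "b $ j" for j] show ?thesis
      by (simp add: l_def inner_vec_def flip: of_real_sum sum_distrib_left)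
  qed
  have l_le: "norm (l b s) \<le> \<epsilon>" if s: "s \<in> doubled (ball p r')" and b: "b \<in> Basis" for b s
  proof -
    obtain z w where zw: "s = join_vec z (conj_vec w)" "norm (z - p) < r'" "norm (w - p) < r'"
      using s by (auto simp: doubled_def dist_norm norm_minus_commute)
    have b1: "norm (b $ j) \<le> 1" for j
      using Finite_Cartesian_Product.norm_nth_le[of b j] norm_Basis[OF b] by simp
    have *: "norm (((z $ j - p $ j) * cnj (b $ j)) + ((cnj (w $ j) - cnj (p $ j)) * b $ j))
        \<le> norm ((z - p) $ j) + norm ((w - p) $ j)" for j
    proof (rule order_trans[OF norm_triangle_ineq add_mono])
      show "norm ((z $ j - p $ j) * cnj (b $ j)) \<le> norm ((z - p) $ j)"
        using mult_left_mono[OF b1[of j], of "norm ((z - p) $ j)"] by (simp add: norm_mult)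
      have "norm (cnj (w $ j) - cnj (p $ j)) = norm ((w - p) $ j)"
        by (metis complex_cnj_diff complex_mod_cnj vector_minus_component)
      then show "norm ((cnj (w $ j) - cnj (p $ j)) * b $ j) \<le> norm ((w - p) $ j)"
        using mult_left_mono[OF b1[of j], of "norm ((w - p) $ j)"] by (simp add: norm_mult)
    qed
    have "norm (l b s) \<le> (\<Sum>j\<in>UNIV. norm ((z - p) $ j) + norm ((w - p) $ j)) * (1/2)"
      unfolding l_def zw(1) norm_mult join_vec_nth conj_vec_nth 
      using sum_norm_le[OF *] by simp
    also have "\<dots> \<le> real CARD('k) * r'"
    proof -
      have *: "(\<Sum>j\<in>UNIV. norm (v $ j)) \<le> real CARD('k) * r'" if "norm v < r'" for v :: "complex ^ 'k"
        by (rule order_trans[OF sum_norm_nth_le]) (use that in \<open>auto intro: mult_left_mono\<close>)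
      show ?thesis
        using add_mono[OF *[OF zw(2)] *[OF zw(3)]] by (simp add: sum.distrib mult_ac)
    qed
    also have "\<dots> \<le> real CARD('k) * (\<epsilon> / real CARD('k))"
      unfolding r'_def by (intro mult_left_mono) auto
    also have "\<dots> = \<epsilon>" by simp
    finally show ?thesis .
  qed
  \<comment> \<open>The absolute values of the terms at the point with all coordinates \<epsilon>
    are the majorants for the Weierstrass test.\<close>
  define M where "M \<alpha> = \<bar>c \<alpha> * (\<Prod>b\<in>(Basis :: (complex ^ 'k) set). \<epsilon> ^ \<alpha> b)\<bar>" for \<alpha>
  have M: "M summable_on (Basis \<rightarrow>\<^sub>E UNIV)"
  proof -
    define x where "x = p + (\<Sum>b\<in>Basis. \<epsilon> *\<^sub>R b)"
    have "norm (x - p) \<le> (\<Sum>b\<in>(Basis :: (complex ^ 'k) set). \<epsilon>)"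
      unfolding x_def add_diff_cancel_left' using pos by (intro sum_norm_le) simp
    also have "\<dots> < r"
      using \<open>r > 0\<close> DIM_positive[where 'a = "complex ^ 'k"] by (simp add: \<epsilon>_def)
    finally have "x \<in> ball p r" by (simp add: dist_norm norm_minus_commute)
    from c[OF this] have "(\<lambda>\<alpha>. c \<alpha> * (\<Prod>b\<in>Basis. ((x - p) \<bullet> b) ^ \<alpha> b)) summable_on (Basis \<rightarrow>\<^sub>E UNIV)"
      by (rule has_sum_imp_summable)
    moreover have "(x - p) \<bullet> b = \<epsilon>" if "b \<in> Basis" for b
      using that by (simp add: x_def)
    ultimately have "(\<lambda>\<alpha>. c \<alpha> * (\<Prod>b\<in>(Basis :: (complex ^ 'k) set). \<epsilon> ^ \<alpha> b)) summable_on (Basis \<rightarrow>\<^sub>E UNIV)"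
      by (simp cong: prod.cong)
    then show ?thesis
      unfolding M_def real_norm_def[symmetric] by (rule iffD1[OF summable_on_iff_abs_summable_on_real])
  qed
  have T_le: "norm (T \<alpha> s) \<le> M \<alpha>" if "s \<in> doubled (ball p r')" for \<alpha> s
  proof -
    have "norm (\<Prod>b\<in>Basis. l b s ^ \<alpha> b) \<le> (\<Prod>b\<in>(Basis :: (complex ^ 'k) set). \<epsilon> ^ \<alpha> b)"
      unfolding prod_norm[symmetric] norm_power using l_le[OF that]
      by (intro prod_mono) (auto intro: power_mono)
    moreover have "(\<Prod>b\<in>(Basis :: (complex ^ 'k) set). \<epsilon> ^ \<alpha> b) \<ge> 0"
      using pos by (intro prod_nonneg) auto
    ultimately show ?thesis
      unfolding T_def M_def norm_mult abs_mult by (intro mult_mono) auto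
  qed
  have l_hol: "hol_fun_on (l b) S" for b S
    unfolding l_def
    by (intro hol_fun_on_mult hol_fun_on_sum hol_fun_on_add hol_fun_on_diff hol_fun_on_nth hol_fun_on_const)
  have "hol_fun_on R (doubled (ball p r'))"
  proof (rule hol_fun_on_uniform_limit)
    show "uniform_limit (doubled (ball p r')) (\<lambda>X s. \<Sum>\<alpha>\<in>X. T \<alpha> s) R
       (finite_subsets_at_top (Basis \<rightarrow>\<^sub>E UNIV))"
      unfolding R_def using T_le M by (intro Weierstrass_m_test_general) auto
    show "\<forall>\<^sub>F X in finite_subsets_at_top (Basis \<rightarrow>\<^sub>E UNIV).
       hol_fun_on (\<lambda>s. \<Sum>\<alpha>\<in>X. T \<alpha> s) (doubled (ball p r'))"
      unfolding T_def
      by (intro always_eventually allI hol_fun_on_sum hol_fun_on_mult hol_fun_on_const 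
          hol_fun_on_prod hol_fun_on_power l_hol)
  qed (auto intro: open_doubled)
  moreover have "R (join_vec z (conj_vec z)) = of_real (\<rho> z)" if "z \<in> ball p r'" for z
  proof -
    have "z \<in> ball p r" using that by (auto simp: r'_def)
    from c[OF this] show ?thesis
      unfolding R_def T_def l_diag
      by (intro infsumI) (simp flip: of_real_power of_real_prod of_real_mult add: has_sum_of_real_iff)
  qed
  ultimately show thesis
    using that[OF pos(2), of R] by (simp add: complexification_def doubled_def)
qed

section \<open>Derivatives of complexifications\<close>

lemma complexification_subset:
  "complexification \<Omega> \<rho> R \<Longrightarrow> open \<Omega>' \<Longrightarrow> connected \<Omega>' \<Longrightarrow> \<Omega>' \<subseteq> \<Omega> \<Longrightarrow> complexification \<Omega>' \<rho> R"
  unfolding complexification_def by (auto elim!: hol_fun_on_subset)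

lemma complexification_hol: "complexification \<Omega> \<rho> R \<Longrightarrow> hol_fun_on R (doubled \<Omega>)"
  by (simp add: complexification_def doubled_def)

text \<open>With \<zeta> frozen, \<open>R\<close> becomes the equation of a Segre variety. The inner
  map is complex affine, and only the \<open>Inl\<close> half of the gradient of \<open>R\<close>
  survives the chain rule.\<close>

lemma complexification_slice_hol:
  assumes "complexification \<Omega> \<rho> R" "w \<in> \<Omega>"
  shows "hol_fun_on (\<lambda>z. R (join_vec z (conj_vec w))) \<Omega>"
    and "z \<in> \<Omega> \<Longrightarrow> pd j (\<lambda>z. R (join_vec z (conj_vec w))) z = pd (Inl j) R (join_vec z (conj_vec w))"
proof -
  have D: "((\<lambda>z. R (join_vec z (conj_vec w))) has_derivative
     (\<lambda>v. \<Sum>j\<in>UNIV. pd (Inl j) R (join_vec z (conj_vec w)) * v $ j)) (at z)" if "z \<in> \<Omega>" for z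
  proof -
    have "((\<lambda>z. join_vec z (conj_vec w)) has_derivative (\<lambda>v. join_vec v 0)) (at z)"
    proof (rule has_derivative_vecI)
      fix i :: "'a + 'a"
      show "((\<lambda>z. join_vec z (conj_vec w) $ i) has_derivative (\<lambda>v. join_vec v 0 $ i)) (at z)"
        by (cases i) (auto intro: bounded_linear_imp_has_derivative bounded_linear_vec_nth)
    qed
    moreover have "join_vec z (conj_vec w) \<in> doubled \<Omega>"
      using that assms(2) by (simp add: doubled_mem)
    ultimately have "((\<lambda>z. R (join_vec z (conj_vec w))) has_derivative
        (\<lambda>v. \<Sum>s\<in>UNIV. pd s R (join_vec z (conj_vec w)) * join_vec v 0 $ s)) (at z)"
      by (rule has_derivative_compose[OF _ hol_fun_has_derivative[OF complexification_hol[OF assms(1)]]])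
    then show ?thesis by (simp add: sum_UNIV_Plus)
  qed
  show "hol_fun_on (\<lambda>z. R (join_vec z (conj_vec w))) \<Omega>"
    by (rule hol_fun_onI[OF D])
  show "z \<in> \<Omega> \<Longrightarrow> pd j (\<lambda>z. R (join_vec z (conj_vec w))) z = pd (Inl j) R (join_vec z (conj_vec w))"
    by (rule pd_eqI[OF D])
qed

text \<open>Chain rule along the real linear embedding of the diagonal. As \<open>R\<close> is real
  there, its derivative has no imaginary part.\<close>

lemma complexification_diag_deriv:
  assumes "complexification \<Omega> \<rho> R" "z \<in> \<Omega>"
  shows "(\<rho> has_derivative (\<lambda>v. Re (\<Sum>s\<in>UNIV. pd s R (join_vec z (conj_vec z)) * join_vec v (conj_vec v) $ s))) (at z)"
    and "Im (\<Sum>s\<in>UNIV. pd s R (join_vec z (conj_vec z)) * join_vec v (conj_vec v) $ s) = 0"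
proof -
  have "((\<lambda>z. join_vec z (conj_vec z)) has_derivative (\<lambda>v. join_vec v (conj_vec v))) (at z)"
  proof (rule has_derivative_vecI)
    fix i :: "'a + 'a"
    show "((\<lambda>z. join_vec z (conj_vec z) $ i) has_derivative (\<lambda>v. join_vec v (conj_vec v) $ i)) (at z)"
      by (cases i) (auto intro!: bounded_linear_imp_has_derivative bounded_linear_vec_nth 
          bounded_linear_compose[OF bounded_linear_cnj])
  qed
  moreover have "join_vec z (conj_vec z) \<in> doubled \<Omega>"
    using assms(2) by (simp add: doubled_mem)
  ultimately have D: "((\<lambda>z. R (join_vec z (conj_vec z))) has_derivative
      (\<lambda>v. \<Sum>s\<in>UNIV. pd s R (join_vec z (conj_vec z)) * join_vec v (conj_vec v) $ s)) (at z)"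
    by (rule has_derivative_compose[OF _ hol_fun_has_derivative[OF complexification_hol[OF assms(1)]]])
  have \<Omega>: "open \<Omega>" "\<And>z. z \<in> \<Omega> \<Longrightarrow> R (join_vec z (conj_vec z)) = of_real (\<rho> z)"
    using assms(1) by (auto simp: complexification_def)
  show "(\<rho> has_derivative (\<lambda>v. Re (\<Sum>s\<in>UNIV. pd s R (join_vec z (conj_vec z)) * join_vec v (conj_vec v) $ s))) (at z)"
    by (rule has_derivative_transform_within_open[OF has_derivative_Re[OF D] \<Omega>(1) assms(2)])
       (simp add: \<Omega>(2))
  have "((\<lambda>z. 0) has_derivative (\<lambda>v. Im (\<Sum>s\<in>UNIV. pd s R (join_vec z (conj_vec z)) * join_vec v (conj_vec v) $ s))) (at z)"
    by (rule has_derivative_transform_within_open[OF has_derivative_Im[OF D] \<Omega>(1) assms(2)])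
       (simp add: \<Omega>(2))
  from has_derivative_unique[OF this has_derivative_const]
  show "Im (\<Sum>s\<in>UNIV. pd s R (join_vec z (conj_vec z)) * join_vec v (conj_vec v) $ s) = 0"
    by (rule fun_cong)
qed

text \<open>If all \<open>\<partial>R/\<partial>Z\<^sub>j\<close> vanished, the real-valued \<open>d\<rho>\<close> would be antilinear.\<close>

lemma complexification_gradient_nonzero:
  assumes "complexification \<Omega> \<rho> R" "z \<in> \<Omega>" "frechet_derivative \<rho> (at z) \<noteq> (\<lambda>_. 0)"
  obtains j where "pd (Inl j) R (join_vec z (conj_vec z)) \<noteq> 0"
proof (rule ccontr)
  assume "\<not> thesis"
  then have 0: "pd (Inl j) R (join_vec z (conj_vec z)) = 0" for j using that by blast
  define L where "L v = (\<Sum>j\<in>UNIV. pd (Inr j) R (join_vec z (conj_vec z)) * cnj (v $ j))" for v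
  have L: "(\<Sum>s\<in>UNIV. pd s R (join_vec z (conj_vec z)) * join_vec v (conj_vec v) $ s) = L v" for v
    by (simp add: L_def sum_UNIV_Plus 0)
  have "Im (L v) = 0" for v
    using complexification_diag_deriv(2)[OF assms(1,2), of v] by (simp only: L)
  moreover have "L (\<i> *s v) = - \<i> * L v" for v
    by (simp add: L_def sum_distrib_left mult_ac sum_negf)
  ultimately have "Re (L v) = 0" for v
    using minus_equation_iff by (metis Im_i_times complex_Im_of_int mult_minus_left uminus_complex.simps(2) neg_equal_0_iff_equal)
  then have "frechet_derivative \<rho> (at z) = (\<lambda>_. 0)"
    using frechet_derivative_at[OF complexification_diag_deriv(1)[OF assms(1,2)]] by (simp only: L)
  then show False using assms(3) by contradiction
qed

text \<open>Supplies the continuous differentiability of \<rho>: its derivative is a combination of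
  partial derivatives of \<open>R\<close> on the diagonal, and these are holomorphic, hence
  continuous.\<close>

lemma complexification_imp_continuous_deriv:
  assumes "complexification \<Omega> \<rho> R"
  shows "continuous_on \<Omega> \<rho>" "continuous_on \<Omega> (\<lambda>z. frechet_derivative \<rho> (at z) v)"
    "\<And>z. z \<in> \<Omega> \<Longrightarrow> (\<rho> has_derivative frechet_derivative \<rho> (at z)) (at z)"
proof -
  show 1: "(\<rho> has_derivative frechet_derivative \<rho> (at z)) (at z)" if "z \<in> \<Omega>" for z
    by (rule has_derivative_eq_rhs[OF complexification_diag_deriv(1)[OF assms that]
          frechet_derivative_at[OF complexification_diag_deriv(1)[OF assms that]]])
  show "continuous_on \<Omega> \<rho>"
    by (rule continuous_at_imp_continuous_on) (use 1 has_derivative_continuous in blast)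
  have "continuous_on \<Omega> (\<lambda>z. Re (\<Sum>s\<in>UNIV. pd s R (join_vec z (conj_vec z)) * join_vec v (conj_vec v) $ s))"
  proof (intro continuous_intros)
    fix s
    have "open \<Omega>" using assms by (simp add: complexification_def)
    then have "continuous_on (doubled \<Omega>) (pd s R)"
      using complexification_hol[OF assms] by (intro hol_fun_on_continuous hol_fun_on_pd open_doubled)
    then show "continuous_on \<Omega> (\<lambda>z. pd s R (join_vec z (conj_vec z)))"
      by (rule continuous_on_compose2) 
         (auto simp: doubled_mem intro: continuous_on_join_conj continuous_on_id)
  qed
  then show "continuous_on \<Omega> (\<lambda>z. frechet_derivative \<rho> (at z) v)"
    by (rule continuous_on_eq)
       (simp add: frechet_derivative_at[OF complexification_diag_deriv(1)[OF assms], symmetric])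
qed

section \<open>Singular families of matrices\<close>

definition outer :: "complex ^ 'n \<Rightarrow> complex ^ 'n \<Rightarrow> complex ^ 'n ^ 'n" where
  "outer u w = (\<chi> i j. u $ i * w $ j)"

text \<open>The pairing is bilinear, without conjugation: \<open>w\<close> acts as a covector, so
  \<open>outer u w\<close> is the rank-one map of \<open>outer_mult\<close>.\<close>

definition bdot :: "complex ^ 'n \<Rightarrow> complex ^ 'n \<Rightarrow> complex" where
  "bdot w x = (\<Sum>j\<in>UNIV. w $ j * x $ j)"

lemma outer_mult: "outer u w *v x = bdot w x *s u"
  by (simp add: outer_def bdot_def matrix_vector_mult_def vec_eq_iff sum_distrib_left sum_distrib_right mult_ac)

lemma outer_diff: "outer u (v - w) = outer u v - outer u w"
  by (simp add: outer_def vec_eq_iff right_diff_distrib)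

lemma sum_outer_mult: "(\<Sum>j\<in>J. outer (u j) (w j)) *v x = (\<Sum>j\<in>J. bdot (w j) x *s u j)"
  by (induction J rule: infinite_finite_induct) (auto simp: matrix_vector_mult_add_rdistrib outer_mult)

lemma matrix_eq_sum_outer: "B = (\<Sum>j\<in>UNIV. outer (column j B) (axis j 1))"
  by (simp add: vec_eq_iff sum_component outer_def column_def sum_mult_axis axis_def if_distrib cong: if_cong)

lemma det_eq_0_imp_kernel:
  fixes A :: "complex ^ 'n ^ 'n"
  assumes "det A = 0"
  obtains y where "y \<noteq> 0" "A *v y = 0"
  using assms invertible_det_nz[of A] invertible_left_inverse[of A] matrix_left_invertible_ker[of A] by blast

lemma kernel_imp_det_eq_0:
  fixes A :: "complex ^ 'n ^ 'n"
  assumes "y \<noteq> 0" "A *v y = 0"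
  shows "det A = 0"
  using assms invertible_det_nz[of A] invertible_left_inverse[of A] matrix_left_invertible_ker[of A] by blast

lemma bdot_diff: "bdot (v - w) x = bdot v x - bdot w x"
  by (simp add: bdot_def left_diff_distrib sum_subtractf)

lemma bdot_scale: "bdot w (c *s x) = c * bdot w x"
  by (simp add: bdot_def sum_distrib_left mult_ac)

text \<open>An instance of the matrix determinant lemma: the determinant of the update is
  \<open>det C * (1 - bdot w x)\<close>. In terms of kernels, a null vector \<open>y\<close> of the
  update satisfies \<open>C *v y = bdot w y *s u\<close>, so it is \<open>bdot w y *s x\<close>, and
  pairing with \<open>w\<close> gives the claim.\<close>

lemma bdot_eq_1:
  assumes "det (C - outer u w) = 0" "det C \<noteq> 0" "C *v x = u"
  shows "bdot w x = 1"
proof -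
  obtain y where y: "y \<noteq> 0" "(C - outer u w) *v y = 0"
    using det_eq_0_imp_kernel[OF assms(1)] .
  have Cy: "C *v y = bdot w y *s u"
    using y(2) by (simp add: matrix_vector_mult_diff_rdistrib outer_mult)
  have "C *v (y - bdot w y *s x) = 0"
    by (simp add: matrix_vector_mult_diff_distrib Cy vector_scalar_commute assms(3))
  then have y': "y = bdot w y *s x"
    using kernel_imp_det_eq_0[of "y - bdot w y *s x" C] assms(2) by auto
  then have nz: "bdot w y \<noteq> 0" using y(1) by auto
  have "bdot w y = bdot w y * bdot w x"
    using arg_cong[OF y', of "bdot w"] by (simp add: bdot_scale)
  then show ?thesis using nz by simp
qed

text \<open>A perturbation \<open>B\<close> of minimal rank making \<open>det (A z + B)\<close> not identically zero satisfies
  \<open>B x = u\<close> for the solution \<open>x\<close> of \<open>(A z + B) x = u\<close>: replacing any of its rank-one terms would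
  lower the rank, so \<open>x\<close> pairs to 1 with one of the covectors and to 0 with the others.\<close>

lemma det_zero_perturbation:
  fixes A :: "'z \<Rightarrow> complex ^ 'n ^ 'n"
  assumes "S \<noteq> {}" and det0: "\<And>z. z \<in> S \<Longrightarrow> det (A z) = 0"
  obtains B u z0 where "z0 \<in> S" "det (A z0 + B) \<noteq> 0"
    "\<And>z x. z \<in> S \<Longrightarrow> det (A z + B) \<noteq> 0 \<Longrightarrow> (A z + B) *v x = u \<Longrightarrow> A z *v x = 0 \<and> x \<noteq> 0"
proof -
  \<comment> \<open>The number \<open>card J\<close> of rank-one terms bounds the rank of the
    perturbation and is what gets minimised.\<close>
  define Q where "Q J u w \<longleftrightarrow> (\<exists>z\<in>S. det (A z + (\<Sum>j\<in>J. outer (u j) (w j))) \<noteq> 0)"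
    for J :: "'n set" and u w
  obtain z1 where "z1 \<in> S" using assms(1) by blast
  \<comment> \<open>Changing all columns turns \<open>A z1\<close> into the identity, so some
    perturbation works.\<close>
  have "Q UNIV (\<lambda>j. column j (mat 1 - A z1)) (\<lambda>j. axis j 1)"
    unfolding Q_def matrix_eq_sum_outer[symmetric] using \<open>z1 \<in> S\<close> by (intro bexI[of _ z1]) auto
  then have "\<exists>m J u w. card J = m \<and> Q J u w" by blast
  then obtain J u w where J: "Q J u w" and min: "\<And>J' u' w'. Q J' u' w' \<Longrightarrow> card J \<le> card J'"
    by (rule exE[OF exists_least_iff[THEN iffD1]]) (metis not_le)
  have "J \<noteq> {}" using J det0 by (auto simp: Q_def)
  then obtain k where k: "k \<in> J" by blast
  define B where "B = (\<Sum>j\<in>J. outer (u j) (w j))"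
  have less: "det (A z + (\<Sum>j\<in>J - {k}. outer (u' j) (w' j))) = 0" if "z \<in> S" for u' w' z
  proof (rule ccontr)
    assume "\<not> ?thesis"
    then have "Q (J - {k}) u' w'" using that by (auto simp: Q_def)
    from min[OF this] show False using card_Diff1_less[OF finite k] by simp
  qed
  obtain z0 where "z0 \<in> S" "det (A z0 + B) \<noteq> 0" using J by (auto simp: Q_def B_def)
  moreover have "A z *v x = 0 \<and> x \<noteq> 0"
    if z: "z \<in> S" and nz: "det (A z + B) \<noteq> 0" and x: "(A z + B) *v x = u k" for z x
  proof -
    have B: "B = outer (u k) (w k) + (\<Sum>j\<in>J - {k}. outer (u j) (w j))"
      unfolding B_def using k by (simp add: sum.remove)
    have "det (A z + B - outer (u k) (w k)) = 0"
      using less[OF z, of u w] by (simp add: B)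
    from bdot_eq_1[OF this nz x] have wk: "bdot (w k) x = 1" .
    have wi: "bdot (w i) x = 0" if i: "i \<in> J - {k}" for i
    proof -
      \<comment> \<open>Replacing \<open>u i\<close> by \<open>u i + u k\<close> in the shorter sum
        amounts to replacing the covector \<open>w k\<close> attached to \<open>u k\<close> in
        \<open>B\<close> by \<open>w i\<close>. There is still one term fewer, so this determinant
        vanishes too.\<close>
      have "(\<Sum>j\<in>J - {k}. outer (if j = i then u j + u k else u j) (w j)) =
          (\<Sum>j\<in>J - {k}. outer (u j) (w j)) + outer (u k) (w i)"
        using i by (simp add: sum.remove[of _ i] vec_eq_iff outer_def algebra_simps)
      then have "det (A z + B - outer (u k) (w k - w i)) = 0"
        using less[OF z, of "\<lambda>j. if j = i then u j + u k else u j" w]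
        by (simp add: B outer_diff algebra_simps)
      from bdot_eq_1[OF this nz x] show ?thesis by (simp add: bdot_diff wk)
    qed
    have "B *v x = u k"
      unfolding B_def sum_outer_mult using k wk wi by (simp add: sum.remove)
    then have "A z *v x = 0" using x by (simp add: matrix_vector_mult_add_rdistrib)
    moreover have "x \<noteq> 0" using wk by (auto simp: bdot_def)
    ultimately show ?thesis by blast
  qed
  ultimately show thesis using that by blast
qed

lemma rank_less_iff_det_eq_0:
  fixes A :: "complex ^ 'n ^ 'n"
  shows "rank A < CARD('n) \<longleftrightarrow> det A = 0"
proof -
  have "rank A = CARD('n) \<longleftrightarrow> vec.span (rows A) = UNIV"
    unfolding row_rank_def_gen
    by (metis vec.dim_UNIV vec.dim_eq_full card_cart_basis vec.dimension_def vec_dim_card)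
  moreover have "\<dots> \<longleftrightarrow> det A \<noteq> 0"
    using invertible_det_nz[of A] invertible_left_inverse[of A] matrix_left_invertible_span_rows_gen[of A] by blast
  moreover have "rank A \<le> CARD('n)"
    unfolding row_rank_def_gen using vec.dim_subset[of "rows A" UNIV] by (simp add: vec_dim_card card_cart_basis)
  ultimately show ?thesis by linarith
qed

section \<open>Fibres transverse to a hypersurface\<close>

text \<open>A point \<open>z\<close> near \<open>q\<close> is moved along \<open>Y\<close> to the zero set of \<open>\<rho>\<close> within its fibre of \<open>H\<close>. Instead
  of integrating \<open>Y\<close>, minimise \<open>m * norm (H w - H z) + \<bar>\<rho> w\<bar> + \<delta> * norm (w - z)\<close>: off the zero
  set of \<open>\<rho>\<close> this decreases to first order along \<open>\<plusminus>Y\<close>.\<close>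

lemma fibre_meets_zero_set:
  fixes \<rho> :: "'a::euclidean_space \<Rightarrow> real" and H :: "'a \<Rightarrow> 'b::real_normed_vector"
  assumes "r > 0" "c > 0" "\<rho> q = 0"
    and \<rho>: "\<And>w. w \<in> cball q r \<Longrightarrow> (\<rho> has_derivative \<rho>' w) (at w)"
    and H: "\<And>w. w \<in> cball q r \<Longrightarrow> (H has_derivative H' w) (at w)"
    and HY: "\<And>w. w \<in> cball q r \<Longrightarrow> H' w (Y w) = 0"
    and \<rho>Y: "\<And>w. w \<in> cball q r \<Longrightarrow> \<rho>' w (Y w) \<ge> c"
    and Y: "\<And>w. w \<in> cball q r \<Longrightarrow> norm (Y w) \<le> L"
  shows "\<exists>\<epsilon>>0. \<forall>z\<in>ball q \<epsilon>. \<exists>w\<in>cball q r. \<rho> w = 0 \<and> H w = H z"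
proof -
  have L: "L \<ge> 0" using order_trans[OF norm_ge_zero Y[of q]] \<open>r > 0\<close> by simp
  \<comment> \<open>Along \<open>Y\<close> the term \<open>\<bar>\<rho>\<bar>\<close> can be lowered
    at rate at least \<open>c\<close>, while the distance term grows at rate at most
    \<open>\<delta> * L\<close>; the strict inequality leaves a net decrease.\<close>
  define \<delta> where "\<delta> = c / (L + 1)"
  have \<delta>: "\<delta> > 0" "\<delta> * L < c" using L \<open>c > 0\<close> by (auto simp: \<delta>_def field_simps)
  have cont: "continuous_on (cball q r) \<rho>" "continuous_on (cball q r) H"
    using \<rho> H by (meson continuous_at_imp_continuous_on has_derivative_continuous)+
  have "isCont \<rho> q" using \<rho>[of q] \<open>r > 0\<close> by (auto intro: has_derivative_continuous)
  moreover have "\<delta> * r / 2 > 0" using \<delta> \<open>r > 0\<close> by simp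
  ultimately have "\<exists>d>0. \<forall>z. dist z q < d \<longrightarrow> dist (\<rho> z) (\<rho> q) < \<delta> * r / 2"
    unfolding continuous_at_eps_delta by blast
  then obtain d where "d > 0" and d: "\<And>z. dist z q < d \<Longrightarrow> \<bar>\<rho> z\<bar> < \<delta> * r / 2"
    using \<open>\<rho> q = 0\<close> by (auto simp: dist_real_def)
  define \<epsilon> where "\<epsilon> = min d (r / 2)"
  \<comment> \<open>For each weight \<open>m\<close> the zero of \<rho> is exact, while
    \<open>H\<close> agrees only up to order \<open>1 / m\<close>; compactness of the zero set
    removes this error at the end.\<close>
  have near: "\<exists>w\<in>cball q r. \<rho> w = 0 \<and> real m * norm (H w - H z) \<le> \<delta> * r / 2"
    if z: "z \<in> ball q \<epsilon>" for z and m :: nat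
  proof -
    define \<phi> where "\<phi> w = real m * norm (H w - H z) + \<bar>\<rho> w\<bar> + \<delta> * norm (w - z)" for w
    have zr: "z \<in> cball q r" using z \<open>r > 0\<close> by (simp add: \<epsilon>_def)
    have "continuous_on (cball q r) \<phi>"
      unfolding \<phi>_def by (intro continuous_intros cont)
    then obtain w where w: "w \<in> cball q r" and min: "\<And>y. y \<in> cball q r \<Longrightarrow> \<phi> w \<le> \<phi> y"
      using continuous_attains_inf[of "cball q r" \<phi>] \<open>r > 0\<close> by auto
    \<comment> \<open>Comparison with the value at \<open>z\<close> keeps the minimiser within
      \<open>r / 2\<close> of \<open>z\<close>, hence off the boundary of
      \<open>cball q r\<close>.\<close>
    have "\<phi> w \<le> \<bar>\<rho> z\<bar>" using min[OF zr] by (simp add: \<phi>_def)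
    also have "\<dots> < \<delta> * r / 2" using z by (intro d) (simp add: \<epsilon>_def dist_commute)
    finally have \<phi>w: "\<phi> w < \<delta> * r / 2" .
    have "\<delta> * norm (w - z) \<le> \<phi> w" by (simp add: \<phi>_def)
    then have "\<delta> * norm (w - z) < \<delta> * (r / 2)" using \<phi>w by simp
    then have "norm (w - z) < r / 2" using \<delta>(1) by simp
    then have w_int: "w \<in> ball q r"
      using z dist_triangle[of q w z] by (simp add: \<epsilon>_def dist_norm norm_minus_commute)
    have "\<rho> w = 0"
    proof (rule ccontr)
      assume nz: "\<rho> w \<noteq> 0"
      \<comment> \<open>With this sign, moving along \<open>Y\<close> drives \<rho> towards
        0.\<close>
      define s where "s = - sgn (\<rho> w)"
      define \<gamma> where "\<gamma> h = w + (h * s) *\<^sub>R Y w" for h :: real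
      have s: "\<bar>s\<bar> = 1" using nz by (simp add: s_def abs_sgn_eq)
      have \<gamma>0: "\<gamma> 0 = w" by (simp add: \<gamma>_def)
      have \<gamma>: "(\<gamma> has_derivative (\<lambda>h. (h * s) *\<^sub>R Y w)) (at 0)"
        unfolding \<gamma>_def by (auto intro!: derivative_eq_intros)
      have lin: "linear (\<rho>' w)" "linear (H' w)"
        using \<rho>[OF w] H[OF w] has_derivative_linear by blast+
      \<comment> \<open>The first-order errors of \<rho> and of \<open>H\<close>, the latter
        weighted by \<open>m\<close>, add up to \<open>(real m + 1) * e * h\<close>, half of the net
        decrease \<open>(c - \<delta> * L) * h\<close>.\<close>
      define e where "e = (c - \<delta> * L) / (2 * (real m + 1))"
      have e: "e > 0" using \<delta> by (simp add: e_def)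
      have H\<gamma>: "((\<lambda>h. H (\<gamma> h)) has_derivative (\<lambda>h. 0)) (at 0)"
      proof -
        have "((\<lambda>h. H (\<gamma> h)) has_derivative (\<lambda>h. H' w ((h * s) *\<^sub>R Y w))) (at 0)"
          using has_derivative_compose[OF \<gamma>] H[OF w] \<gamma>0 by metis
        then show ?thesis by (simp add: linear_scale[OF lin(2)] HY[OF w])
      qed
      have \<rho>\<gamma>: "((\<lambda>h. \<rho> (\<gamma> h)) has_derivative (\<lambda>h. h * (s * \<rho>' w (Y w)))) (at 0)"
      proof -
        have "((\<lambda>h. \<rho> (\<gamma> h)) has_derivative (\<lambda>h. \<rho>' w ((h * s) *\<^sub>R Y w))) (at 0)"
          using has_derivative_compose[OF \<gamma>] \<rho>[OF w] \<gamma>0 by metis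
        then show ?thesis by (simp add: linear_scale[OF lin(1)] mult.assoc)
      qed
      obtain d1 where "d1 > 0" and d1: "\<And>h. \<bar>h\<bar> < d1 \<Longrightarrow> norm (H (\<gamma> h) - H w) \<le> e * \<bar>h\<bar>"
        using H\<gamma> e unfolding has_derivative_at_alt \<gamma>0 by (auto simp: \<gamma>0)
      obtain d2 where "d2 > 0" and
        d2: "\<And>h. \<bar>h\<bar> < d2 \<Longrightarrow> \<bar>\<rho> (\<gamma> h) - \<rho> w - h * (s * \<rho>' w (Y w))\<bar> \<le> e * \<bar>h\<bar>"
        using \<rho>\<gamma> e unfolding has_derivative_at_alt by (auto simp: \<gamma>0)
      have "isCont \<gamma> 0" using \<gamma> by (rule has_derivative_continuous)
      then have "\<forall>\<^sub>F h in at 0. \<gamma> h \<in> ball q r"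
        using w_int \<gamma>0 by (metis continuous_at open_ball topological_tendstoD)
      then obtain d3 where "d3 > 0" and d3: "\<And>h. h \<noteq> 0 \<Longrightarrow> \<bar>h\<bar> < d3 \<Longrightarrow> \<gamma> h \<in> ball q r"
        unfolding eventually_at by (auto simp: dist_real_def)
      \<comment> \<open>The last bound keeps the linear approximation of \<rho> from overshooting
        0.\<close>
      define h where "h = min (min d1 d2) (min d3 (\<bar>\<rho> w\<bar> / (\<rho>' w (Y w)))) / 2"
      have \<rho>'pos: "\<rho>' w (Y w) > 0" "\<rho>' w (Y w) \<ge> c" using \<rho>Y[OF w] \<open>c > 0\<close> by auto
      have h: "h > 0" "h < d1" "h < d2" "h < d3" "h < \<bar>\<rho> w\<bar> / \<rho>' w (Y w)"
      proof -
        define a where "a = \<bar>\<rho> w\<bar> / \<rho>' w (Y w)"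
        have "a > 0" using nz \<rho>'pos by (simp add: a_def)
        then show "h > 0" "h < d1" "h < d2" "h < d3" "h < \<bar>\<rho> w\<bar> / \<rho>' w (Y w)"
          using \<open>d1 > 0\<close> \<open>d2 > 0\<close> \<open>d3 > 0\<close> unfolding h_def a_def[symmetric]
          by (auto simp: min_def)
      qed
      have "h * \<rho>' w (Y w) < \<bar>\<rho> w\<bar>" using h(5) \<rho>'pos by (simp add: field_simps)
      then have "\<bar>\<rho> w + h * (s * \<rho>' w (Y w))\<bar> = \<bar>\<rho> w\<bar> - h * \<rho>' w (Y w)"
        using nz by (cases "\<rho> w > 0") (auto simp: s_def)
      then have 1: "\<bar>\<rho> (\<gamma> h)\<bar> \<le> \<bar>\<rho> w\<bar> - h * c + e * h"
        using d2[of h] h(1,3) mult_left_mono[OF \<rho>'pos(2), of h] by linarith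
      have "norm (H (\<gamma> h) - H z) \<le> norm (H w - H z) + e * h"
        using d1[of h] h norm_triangle_ineq[of "H (\<gamma> h) - H w" "H w - H z"] by simp
      then have 2: "real m * norm (H (\<gamma> h) - H z) \<le> real m * norm (H w - H z) + real m * (e * h)"
        using mult_left_mono[of _ _ "real m"] by (fastforce simp: distrib_left)
      have "norm (\<gamma> h - z) \<le> norm (w - z) + h * L"
      proof -
        have "\<gamma> h - z = (w - z) + (h * s) *\<^sub>R Y w" by (simp add: \<gamma>_def)
        moreover have "norm ((h * s) *\<^sub>R Y w) \<le> h * L"
          using h s Y[OF w] by (simp add: abs_mult)
        ultimately show ?thesis
          using norm_triangle_ineq[of "w - z" "(h * s) *\<^sub>R Y w"] by (metis add_left_mono order_trans)
      qed
      then have 3: "\<delta> * norm (\<gamma> h - z) \<le> \<delta> * norm (w - z) + h * (\<delta> * L)"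
        using mult_left_mono[of _ _ \<delta>] \<delta>(1) by (fastforce simp: algebra_simps)
      have "\<phi> w \<le> \<phi> (\<gamma> h)" using d3[of h] h by (intro min) auto
      then have "h * c \<le> e * h + real m * (e * h) + h * (\<delta> * L)"
        using 1 2 3 by (simp add: \<phi>_def)
      then have "h * (c - \<delta> * L) \<le> h * ((real m + 1) * e)" by (simp add: algebra_simps)
      then have "c - \<delta> * L \<le> (real m + 1) * e" using h(1) by simp
      moreover have "(real m + 1) * e = (c - \<delta> * L) / 2"
        unfolding e_def using of_nat_0_le_iff[of m] by (auto simp: divide_simps)
      ultimately have "c - \<delta> * L \<le> (c - \<delta> * L) / 2" by metis
      then show False using \<delta>(2) by (auto simp: field_simps)
    qed
    moreover have "real m * norm (H w - H z) \<le> \<phi> w" using \<delta> by (simp add: \<phi>_def)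
    ultimately show ?thesis using w \<phi>w by (intro bexI[of _ w]) auto
  qed
  have "\<exists>w\<in>cball q r. \<rho> w = 0 \<and> H w = H z" if z: "z \<in> ball q \<epsilon>" for z
  proof -
    define K where "K = {w \<in> cball q r. \<rho> w = 0}"
    have "compact K"
    proof -
      have "closed K"
        unfolding K_def using continuous_closed_preimage[OF cont(1) closed_cball closed_singleton[of 0]]
        by (simp add: vimage_def Int_def conj_commute)
      then show ?thesis using compact_Int_closed[of "cball q r" K]
        by (simp add: K_def Int_absorb1 Collect_mono_iff inf_absorb2 subset_iff)
    qed
    \<comment> \<open>The weight \<open>m = 0\<close> already yields a zero of \<rho>.\<close>
    moreover have "K \<noteq> {}" using near[OF z, of 0] by (auto simp: K_def)
    moreover have "continuous_on K (\<lambda>w. norm (H w - H z))"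
      by (intro continuous_intros continuous_on_subset[OF cont(2)]) (auto simp: K_def)
    ultimately obtain w where w: "w \<in> K" and min: "\<And>y. y \<in> K \<Longrightarrow> norm (H w - H z) \<le> norm (H y - H z)"
      using continuous_attains_inf by meson
    have "real m * norm (H w - H z) \<le> \<delta> * r / 2" for m
    proof -
      obtain y where "y \<in> K" "real m * norm (H y - H z) \<le> \<delta> * r / 2"
        using near[OF z, of m] by (auto simp: K_def)
      then show ?thesis using mult_left_mono[OF min[of y], of "real m"] by simp
    qed
    then have "norm (H w - H z) = 0"
      by (metis norm_ge_zero not_le real_archimedian_rdiv_eq_0)
    then show ?thesis using w by (auto simp: K_def)
  qed
  moreover have "\<epsilon> > 0" using \<open>d > 0\<close> \<open>r > 0\<close> by (simp add: \<epsilon>_def)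
  ultimately show ?thesis by blast
qed

section \<open>Uniqueness\<close>

text \<open>Supplies the connected parameter domains for the one-variable identity theorem; the
  conjugated form serves the polarized lines.\<close>

lemma convex_line_preimage:
  assumes "convex (N :: (complex ^ 'k) set)"
  shows "convex {t. z + t *s u \<in> N}" "convex {t. z + cnj t *s u \<in> N}"
proof -
  have *: "z + ((1 - x) *\<^sub>R a + x *\<^sub>R b) *s u = (1 - x) *\<^sub>R (z + a *s u) + x *\<^sub>R (z + b *s u)" for x a b
    unfolding vec_eq_iff vector_scaleR_component vector_add_component vector_smult_component
    by (simp add: scaleR_conv_of_real algebra_simps)
  have **: "z + cnj ((1 - x) *\<^sub>R a + x *\<^sub>R b) *s u
      = (1 - x) *\<^sub>R (z + cnj a *s u) + x *\<^sub>R (z + cnj b *s u)" for x a b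
    unfolding vec_eq_iff vector_scaleR_component vector_add_component vector_smult_component
    by (simp add: scaleR_conv_of_real algebra_simps)
  show "convex {t. z + t *s u \<in> N}" "convex {t. z + cnj t *s u \<in> N}"
    using assms unfolding convex_alt mem_Collect_eq * ** by blast+
qed

lemma open_line_preimage:
  assumes "open (N :: (complex ^ 'k) set)"
  shows "open {t. z + t *s u \<in> N}" "open {t. z + cnj t *s u \<in> N}"
proof -
  have "continuous_on UNIV (\<lambda>t. z + cnj t *s u)"
    by (rule continuous_on_compose2[OF continuous_on_line[of UNIV]]) (auto intro: continuous_intros)
  from open_vimage[OF assms this] open_vimage[OF assms continuous_on_line[of UNIV z u]]
  show "open {t. z + t *s u \<in> N}" "open {t. z + cnj t *s u \<in> N}"
    by (simp_all add: vimage_def)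
qed

text \<open>The identity theorem in one variable on the complex line through \<open>q\<close> and
  \<open>z\<close>; convexity of \<open>N\<close> makes the set of parameters connected.\<close>

lemma hol_fun_zero_on_convex:
  fixes g :: "complex ^ 'k \<Rightarrow> complex"
  assumes "open N" "convex N" "hol_fun_on g N"
    and S: "open S" "S \<subseteq> N" "q \<in> S" "\<And>x. x \<in> S \<Longrightarrow> g x = 0"
    and z: "z \<in> N"
  shows "g z = 0"
proof -
  define T where "T = {t. q + t *s (z - q) \<in> N}"
  have "g (q + 1 *s (z - q)) = 0"
  proof (rule analytic_continuation_open[where f = "\<lambda>t. g (q + t *s (z - q))" and g = "\<lambda>_. 0"
        and z = 1 and s = "{t. q + t *s (z - q) \<in> S}" and s' = T])
    show "(\<lambda>t. g (q + t *s (z - q))) holomorphic_on T"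
      by (rule hol_fun_line_holomorphic[OF assms(3)]) (auto simp: T_def)
    show "connected T" unfolding T_def by (rule convex_connected[OF convex_line_preimage(1)[OF assms(2)]])
    have "0 \<in> {t. q + t *s (z - q) \<in> S}" using S by simp
    then show "{t. q + t *s (z - q) \<in> S} \<noteq> {}" by blast
    show "open {t. q + t *s (z - q) \<in> S}" "open T"
      unfolding T_def by (rule open_line_preimage(1)[OF S(1)], rule open_line_preimage(1)[OF assms(1)])
  qed (use S z in \<open>auto simp: T_def\<close>)
  then show ?thesis by simp
qed

lemma of_real_smult: "complex_of_real a *s v = a *\<^sub>R v"
  unfolding vec_eq_iff vector_scaleR_component vector_smult_component
  by (simp add: scaleR_conv_of_real)

section \<open>Local equations of hypersurfaces and vanishing on them\<close>

lemma real_analytic_hypersurfaceE: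
  assumes "real_analytic_hypersurface M" "p \<in> M"
  obtains \<Omega> \<rho> where "p \<in> \<Omega>" "defining_function M \<Omega> \<rho>"
  using assms unfolding real_analytic_hypersurface_def by blast

text \<open>The ball of the power series is shrunk into \<Omega> and \<open>G\<close>. Both notions
  pass to smaller balls, which remain connected as \<open>complexification\<close> demands.\<close>

lemma defining_function_complexification:
  assumes "defining_function M \<Omega> \<rho>" "p \<in> \<Omega>" "open G" "p \<in> G"
  obtains r R where "r > 0" "ball p r \<subseteq> \<Omega> \<inter> G" "complexification (ball p r) \<rho> R"
    "defining_function M (ball p r) \<rho>"
proof -
  have \<Omega>: "open \<Omega>" "real_analytic_at \<rho> p" using assms(1,2) by (auto simp: defining_function_def)
  obtain r0 R where r0: "r0 > 0" "complexification (ball p r0) \<rho> R"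
    using real_analytic_complexification[OF \<Omega>(2)] .
  obtain r1 where r1: "r1 > 0" "ball p r1 \<subseteq> \<Omega> \<inter> G"
    using \<Omega>(1) assms(2-4) open_contains_ball[of "\<Omega> \<inter> G"] by blast
  define r where "r = min r0 r1"
  have sub: "ball p r \<subseteq> \<Omega> \<inter> G" "ball p r \<subseteq> ball p r0" using r1 by (auto simp: r_def)
  have "complexification (ball p r) \<rho> R"
    by (rule complexification_subset[OF r0(2)]) (use sub in auto)
  moreover have "defining_function M (ball p r) \<rho>"
    using assms(1) sub unfolding defining_function_def by auto
  ultimately show thesis using that[of r R] sub r0 r1 by (auto simp: r_def)
qed

text \<open>For \<open>z\<close> near \<open>p\<close> and \<open>v\<close> transverse to \<open>M\<close>, the complex line \<open>z + t v\<close> meets \<open>M\<close> at a parameter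
  of every small imaginary part, by the intermediate value theorem; so \<open>t \<mapsto> g (z + t v)\<close> has
  accumulating zeros.\<close>

lemma hol_fun_zero_near_hypersurface:
  fixes g :: "complex ^ 'k \<Rightarrow> complex"
  assumes M: "real_analytic_hypersurface M" "p \<in> M"
    and "open G" "p \<in> G" and g: "hol_fun_on g G" "\<And>x. x \<in> M \<inter> G \<Longrightarrow> g x = 0"
  obtains \<epsilon> where "\<epsilon> > 0" "ball p \<epsilon> \<subseteq> G" "\<And>z. z \<in> ball p \<epsilon> \<Longrightarrow> g z = 0"
proof -
  obtain \<Omega> \<rho> where \<Omega>: "p \<in> \<Omega>" "defining_function M \<Omega> \<rho>"
    using real_analytic_hypersurfaceE[OF M] .
  obtain r R where r: "r > 0" "ball p r \<subseteq> \<Omega> \<inter> G" "complexification (ball p r) \<rho> R"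
    and def: "defining_function M (ball p r) \<rho>"
    using defining_function_complexification[OF \<Omega>(2,1) \<open>open G\<close> \<open>p \<in> G\<close>] .
  have M_eq: "x \<in> M \<longleftrightarrow> \<rho> x = 0" if "x \<in> ball p r" for x
    using def that unfolding defining_function_def by blast
  have cont: "continuous_on (ball p r) \<rho>"
    by (rule complexification_imp_continuous_deriv(1)[OF r(3)])
  define D where "D = frechet_derivative \<rho> (at p)"
  have D: "(\<rho> has_derivative D) (at p)"
    unfolding D_def using r(1) by (intro complexification_imp_continuous_deriv(3)[OF r(3)]) simp
  have "D \<noteq> (\<lambda>_. 0)" using def r(1) by (auto simp: defining_function_def D_def)
  then obtain v0 where "D v0 \<noteq> 0" by blast
  define v where "v = sgn (D v0) *\<^sub>R v0"
  have lin: "linear D" using D by (rule has_derivative_linear)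
  have Dv: "D v > 0"
    using \<open>D v0 \<noteq> 0\<close> by (auto simp: v_def sgn_if linear_neg[OF lin])
  have der: "((\<lambda>t. \<rho> (p + t *\<^sub>R v)) has_real_derivative D v) (at 0)"
  proof -
    have "((\<lambda>t. p + t *\<^sub>R v) has_derivative (\<lambda>t. t *\<^sub>R v)) (at 0)"
      by (auto intro!: derivative_eq_intros)
    from has_derivative_compose[OF this, of \<rho> D] D show ?thesis
      by (simp add: has_field_derivative_def linear_scale[OF lin] mult.commute[of _ "D v"])
  qed
  have p0: "\<rho> p = 0" using M_eq[of p] M(2) r(1) by simp
  obtain d1 where d1: "d1 > 0" "\<And>h. 0 < h \<Longrightarrow> h < d1 \<Longrightarrow> \<rho> (p + h *\<^sub>R v) > 0"
    using DERIV_pos_inc_right[OF der Dv] p0 by auto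
  obtain d2 where d2: "d2 > 0" "\<And>h. 0 < h \<Longrightarrow> h < d2 \<Longrightarrow> \<rho> (p - h *\<^sub>R v) < 0"
    using DERIV_pos_inc_left[OF der Dv] p0 by auto
  \<comment> \<open>At \<open>p + \<tau> *\<^sub>R v\<close> and
    \<open>p - \<tau> *\<^sub>R v\<close> the signs of \<rho> are opposite, and parameters of
    modulus up to \<open>2 * \<tau>\<close> stay in the ball.\<close>
  define \<tau> where "\<tau> = min (min d1 d2) (r / (2 * (norm v + 1))) / 2"
  have vpos: "norm v + 1 > 0" using norm_ge_zero[of v] by linarith
  have \<tau>: "\<tau> > 0" "\<tau> < d1" "\<tau> < d2" "2 * \<tau> \<le> r / (2 * (norm v + 1))"
  proof -
    define a where "a = r / (2 * (norm v + 1))"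
    have "a > 0" using r(1) vpos by (simp add: a_def)
    then show "\<tau> > 0" "\<tau> < d1" "\<tau> < d2" "2 * \<tau> \<le> r / (2 * (norm v + 1))"
      using d1(1) d2(1) unfolding \<tau>_def a_def[symmetric] by (auto simp: min_def)
  qed
  have small: "norm (t *s v) \<le> r / 2" if "norm t \<le> 2 * \<tau>" for t
  proof -
    have "norm t * norm v \<le> (2 * \<tau>) * (norm v + 1)" using that \<tau>(1) by (intro mult_mono) auto
    also have "\<dots> \<le> r / (2 * (norm v + 1)) * (norm v + 1)"
      using \<tau>(4) vpos by (intro mult_right_mono) auto
    also have "\<dots> = r / 2" using vpos by (simp add: field_simps)
    finally show ?thesis by (simp add: norm_vector_scalar_mult)
  qed
  have mem: "z + t *s v \<in> ball p r" if "norm (z - p) < r / 2" "norm t \<le> 2 * \<tau>" for z t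
    using norm_triangle_ineq[of "z - p" "t *s v"] small[OF that(2)] that(1)
    by (simp add: dist_norm norm_minus_commute[of p] algebra_simps)
  have "p + \<tau> *\<^sub>R v \<in> ball p r" "p - \<tau> *\<^sub>R v \<in> ball p r"
    using mem[of p "of_real \<tau>"] mem[of p "of_real (- \<tau>)"] r(1) \<tau>(1) unfolding of_real_smult
    by simp_all
  then have isCont: "isCont \<rho> (p + \<tau> *\<^sub>R v)" "isCont \<rho> (p - \<tau> *\<^sub>R v)"
    using cont by (simp_all add: continuous_on_eq_continuous_at)
  have near: "\<exists>\<delta>>0. \<forall>x. dist x a < \<delta> \<longrightarrow> \<bar>\<rho> x - \<rho> a\<bar> < \<bar>\<rho> a\<bar>" if "isCont \<rho> a" "\<rho> a \<noteq> 0" for a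
    using that unfolding continuous_at_eps_delta dist_real_def by auto
  have pos: "\<rho> (p + \<tau> *\<^sub>R v) > 0" and neg: "\<rho> (p - \<tau> *\<^sub>R v) < 0"
    using d1(2)[OF \<tau>(1,2)] d2(2)[OF \<tau>(1,3)] .
  obtain \<delta>1 where \<delta>1: "\<delta>1 > 0" "\<And>x. dist x (p + \<tau> *\<^sub>R v) < \<delta>1 \<Longrightarrow> \<rho> x > 0"
    using near[OF isCont(1)] pos by fastforce
  obtain \<delta>2 where \<delta>2: "\<delta>2 > 0" "\<And>x. dist x (p - \<tau> *\<^sub>R v) < \<delta>2 \<Longrightarrow> \<rho> x < 0"
    using near[OF isCont(2)] neg by fastforce
  define \<delta> where "\<delta> = min \<delta>1 \<delta>2"
  have \<delta>: "\<delta> > 0" "\<delta> \<le> \<delta>1" "\<delta> \<le> \<delta>2" using \<delta>1(1) \<delta>2(1) by (auto simp: \<delta>_def)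
  define \<epsilon> where "\<epsilon> = min (r / 2) (\<delta> / 2)"
  \<comment> \<open>For imaginary parts below \<sigma> and \<open>z\<close> near \<open>p\<close>,
    the end points with real parts -\<tau> and \<tau> stay so close to those on the line through
    \<open>p\<close> that the signs of \<rho> persist.\<close>
  define \<sigma> where "\<sigma> = min (\<tau> / 2) (\<delta> / (2 * (norm v + 1)))"
  have "\<sigma> > 0" using \<tau>(1) \<delta>(1) vpos by (simp add: \<sigma>_def)
  moreover have "\<sigma> \<le> \<tau> / 2" unfolding \<sigma>_def by (rule min.cobounded1)
  ultimately have \<sigma>: "\<sigma> > 0" "\<sigma> \<le> \<tau> / 2" .
  have \<sigma>v: "norm (t *s v) \<le> \<delta> / 2" if "norm t \<le> \<sigma>" for t
  proof -
    have "norm t * norm v \<le> \<sigma> * (norm v + 1)" using that \<sigma>(1) by (intro mult_mono) auto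
    also have "\<dots> \<le> \<delta> / (2 * (norm v + 1)) * (norm v + 1)"
      using vpos by (intro mult_right_mono) (auto simp: \<sigma>_def)
    also have "\<dots> = \<delta> / 2" using vpos by (simp add: field_simps)
    finally show ?thesis by (simp add: norm_vector_scalar_mult)
  qed
  have "g z = 0" if z: "z \<in> ball p \<epsilon>" for z
  proof -
    have zp: "norm (z - p) < r / 2" "norm (z - p) < \<delta> / 2"
      using z by (auto simp: \<epsilon>_def dist_norm norm_minus_commute)
    \<comment> \<open>The radius covers real parts up to \<tau> with imaginary parts up to
      \<open>\<tau> / 2\<close>, and is less than \<open>2 * \<tau>\<close>, so limit points of
      \<open>Z\<close> are interior to the disc of holomorphy.\<close>
    define Z where "Z = {t. norm t \<le> 3 / 2 * \<tau> \<and> \<rho> (z + t *s v) = 0}"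
    have "\<exists>t\<in>Z. Im t = s" if s: "s \<in> {0<..<\<sigma>}" for s
    proof -
      define c where "c x = Complex x s" for x
      have c: "c x *s v = x *\<^sub>R v + (\<i> * of_real s) *s v" for x
        by (simp add: c_def Complex_eq vector_sadd_rdistrib of_real_smult)
      have c_le: "norm (c x) \<le> 3 / 2 * \<tau>" if "\<bar>x\<bar> \<le> \<tau>" for x
        using cmod_le[of "c x"] that s \<sigma>(2) by (simp add: c_def)
      have im: "norm ((\<i> * of_real s) *s v) \<le> \<delta> / 2" using s by (intro \<sigma>v) (simp add: norm_mult)
      have close: "dist (z + c x *s v) (p + x *\<^sub>R v) < \<delta>" for x
        using im zp(2) norm_triangle_ineq[of "z - p" "(\<i> * of_real s) *s v"]
        unfolding c dist_norm by (simp add: algebra_simps)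
      have "\<exists>x\<ge>- \<tau>. x \<le> \<tau> \<and> \<rho> (z + c x *s v) = 0"
      proof (rule IVT')
        show "\<rho> (z + c (- \<tau>) *s v) \<le> 0" using \<delta>2(2)[of "z + c (- \<tau>) *s v"] close[of "- \<tau>"] \<delta>(3) by simp
        show "0 \<le> \<rho> (z + c \<tau> *s v)" using \<delta>1(2)[of "z + c \<tau> *s v"] close[of \<tau>] \<delta>(2) by simp
        show "continuous_on {- \<tau>..\<tau>} (\<lambda>x. \<rho> (z + c x *s v))"
        proof (rule continuous_on_compose2[OF cont])
          show "continuous_on {- \<tau>..\<tau>} (\<lambda>x. z + c x *s v)"
            unfolding c by (intro continuous_intros)
          show "(\<lambda>x. z + c x *s v) ` {- \<tau>..\<tau>} \<subseteq> ball p r"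
          proof
            fix y assume "y \<in> (\<lambda>x. z + c x *s v) ` {- \<tau>..\<tau>}"
            then obtain x where x: "y = z + c x *s v" and "x \<in> {- \<tau>..\<tau>}" by blast
            then have "\<bar>x\<bar> \<le> \<tau>" by auto
            show "y \<in> ball p r"
              unfolding x using c_le[OF \<open>\<bar>x\<bar> \<le> \<tau>\<close>] \<tau>(1) by (intro mem[OF zp(1)]) linarith
          qed
        qed
      qed (use \<tau>(1) in auto)
      then obtain x where "- \<tau> \<le> x" "x \<le> \<tau>" "\<rho> (z + c x *s v) = 0" by blast
      moreover from this have "\<bar>x\<bar> \<le> \<tau>" by simp
      ultimately show ?thesis using c_le[of x] by (intro bexI[of _ "c x"]) (auto simp: Z_def c_def)
    qed
    then have "{0<..<\<sigma>} \<subseteq> Im ` Z" by blast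
    \<comment> \<open>Distinct imaginary parts give distinct zeros.\<close>
    then have "infinite (Im ` Z)" using infinite_Ioo[OF \<sigma>(1)] finite_subset by blast
    then have "infinite Z" by blast
    moreover have "Z \<subseteq> cball 0 (3 / 2 * \<tau>)" by (auto simp: Z_def)
    ultimately obtain \<xi> where \<xi>: "\<xi> \<in> cball 0 (3 / 2 * \<tau>)" "\<xi> islimpt Z"
      using compact_cball[of "0::complex"] unfolding compact_eq_Bolzano_Weierstrass by meson
    have in_G: "z + t *s v \<in> ball p r \<inter> G" if "norm t \<le> 2 * \<tau>" for t
      using mem[OF zp(1) that] r(2) by blast
    have "g (z + 0 *s v) = 0"
    proof (rule analytic_continuation[of "\<lambda>t. g (z + t *s v)" "ball 0 (2 * \<tau>)" Z \<xi> 0])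
      show "(\<lambda>t. g (z + t *s v)) holomorphic_on ball 0 (2 * \<tau>)"
        by (rule hol_fun_line_holomorphic[OF g(1)]) (use in_G in auto)
      show "g (z + t *s v) = 0" if "t \<in> Z" for t
      proof -
        have "z + t *s v \<in> ball p r \<inter> G" using that \<tau>(1) by (intro in_G) (auto simp: Z_def)
        then show ?thesis using that g(2) M_eq by (auto simp: Z_def)
      qed
    qed (use \<xi> \<tau>(1) in \<open>auto simp: Z_def\<close>)
    then show ?thesis by simp
  qed
  moreover have "\<epsilon> > 0" "ball p \<epsilon> \<subseteq> G"
    using r(1,2) \<delta>(1) by (auto simp: \<epsilon>_def)
  ultimately show thesis using that by blast
qed

text \<open>Evaluating at \<open>t = \<i>\<close> leaves the diagonal \<open>{(Z, conj Z)}\<close>, evaluating at \<open>t = 1\<close> stays on it.\<close>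

lemma polarized_line_zero:
  fixes H :: "complex ^ 'k \<Rightarrow> complex ^ 'm"
  assumes N: "open N" "convex N" and H: "hol_map_on H N" "H ` N \<subseteq> \<Omega>"
    and R: "complexification \<Omega> \<rho> R"
    and "z \<in> N" "d > 0"
    and zero: "\<And>a. 0 < a \<Longrightarrow> a < d \<Longrightarrow> z + a *\<^sub>R u \<in> N \<Longrightarrow> \<rho> (H (z + a *\<^sub>R u)) = 0"
    and t: "z + t *s u \<in> N" "z + cnj t *s u \<in> N"
  shows "R (join_vec (H (z + t *s u)) (conj_vec (H (z + cnj t *s u)))) = 0"
proof -
  define T where "T = {t. z + t *s u \<in> N} \<inter> {t. z + cnj t *s u \<in> N}"
  \<comment> \<open>Conjugating both the parameter and the value of \<open>H\<close> makes the
    second argument holomorphic in \<open>t\<close>.\<close>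
  define \<phi> where "\<phi> t = R (join_vec (H (z + t *s u)) (conj_vec (H (z + cnj t *s u))))" for t
  have openT: "open T" unfolding T_def using open_line_preimage[OF N(1)] by blast
  have conT: "connected T"
    unfolding T_def using convex_line_preimage[OF N(2)] by (intro convex_connected convex_Int)
  have "\<phi> holomorphic_on T"
    unfolding holomorphic_on_def
  proof
    fix t assume t: "t \<in> T"
    define \<gamma> where "\<gamma> t = join_vec (H (z + t *s u)) (conj_vec (H (z + cnj t *s u)))" for t
    have comp: "hol_fun_on (\<lambda>z. H z $ j) N" for j using H(1) by (simp add: hol_map_on_def)
    define F where "F j t = (\<Sum>i\<in>UNIV. pd i (\<lambda>z. H z $ j) (z + t *s u) * u $ i)" for j t
    have F: "((\<lambda>t. H (z + t *s u) $ j) has_field_derivative F j t) (at t)" if "z + t *s u \<in> N" for j t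
      unfolding F_def by (rule hol_fun_line_deriv[OF comp that])
    have "((\<lambda>t. \<gamma> t $ s) has_field_derivative (case s of Inl j \<Rightarrow> F j t | Inr j \<Rightarrow> cnj (F j (cnj t)))) (at t)"
      for s
    proof (cases s)
      case (Inl j)
      then show ?thesis using F[of t j] t by (simp add: \<gamma>_def T_def)
    next
      case (Inr j)
      show ?thesis
        using has_field_derivative_cnj_cnj[OF F[of "cnj t" j]] t Inr
        by (simp add: \<gamma>_def T_def o_def)
    qed
    moreover have "\<gamma> t \<in> doubled \<Omega>" using t H(2) by (auto simp: \<gamma>_def T_def doubled_mem)
    ultimately have "(\<lambda>t. R (\<gamma> t)) field_differentiable at t"
      using hol_fun_comp_curve[OF complexification_hol[OF R]] field_differentiable_def by blast
    then show "\<phi> field_differentiable at t within T"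
      unfolding \<phi>_def \<gamma>_def by (rule field_differentiable_at_within)
  qed
  moreover have "0 \<in> T" using \<open>z \<in> N\<close> by (simp add: T_def)
  \<comment> \<open>At real parameters the two points coincide, so the hypothesis on \<rho> yields
    zeros of \<phi>; small positive ones accumulate at 0.\<close>
  moreover have "0 islimpt complex_of_real ` {0<..<d} \<inter> T"
  proof -
    obtain r where r: "r > 0" "ball 0 r \<subseteq> T" using openT \<open>0 \<in> T\<close> open_contains_ball by blast
    show ?thesis
      unfolding islimpt_approachable
    proof (intro allI impI)
      fix e :: real assume "e > 0"
      define x where "x = min (min d e) r / 2"
      have x: "x > 0" "x < d" "x < e" "x < r"
        using \<open>d > 0\<close> \<open>e > 0\<close> r(1) by (auto simp: x_def min_def)
      then have "complex_of_real x \<in> T" by (intro subsetD[OF r(2)]) simp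
      moreover have "complex_of_real x \<in> complex_of_real ` {0<..<d}"
        by (rule imageI) (use x in simp)
      moreover have "complex_of_real x \<noteq> 0" "dist (complex_of_real x) 0 < e" using x by auto
      ultimately show "\<exists>y\<in>complex_of_real ` {0<..<d} \<inter> T. y \<noteq> 0 \<and> dist y 0 < e" by blast
    qed
  qed
  moreover have "\<phi> a = 0" if a: "a \<in> complex_of_real ` {0<..<d} \<inter> T" for a
  proof -
    obtain x where x: "a = of_real x" "0 < x" "x < d" using a by auto
    then have "z + x *\<^sub>R u \<in> N" using a by (simp add: T_def of_real_smult)
    then have "\<rho> (H (z + x *\<^sub>R u)) = 0" "H (z + x *\<^sub>R u) \<in> \<Omega>"
      using zero[OF x(2,3)] H(2) by auto
    then show ?thesis
      using R unfolding \<phi>_def x(1) complex_cnj_complex_of_real of_real_smult complexification_def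
      by simp
  qed
  ultimately have "\<phi> t = 0"
    using analytic_continuation[of \<phi> T "complex_of_real ` {0<..<d} \<inter> T" 0 t] openT conT t
    by (auto simp: T_def)
  then show ?thesis by (simp add: \<phi>_def)
qed

section \<open>Mappings between hypersurfaces\<close>

lemma hol_fun_on_jacobian:
  assumes "open U" "hol_map_on H U"
  shows "hol_fun_on (\<lambda>z. jacobian H (at z) $ i $ j) U"
proof (rule hol_fun_on_cong[OF assms(1)])
  show "hol_fun_on (pd j (\<lambda>z. H z $ i)) U"
    using assms by (intro hol_fun_on_pd) (auto simp: hol_map_on_def)
qed (simp add: hol_map_has_derivative(2)[OF assms(2)])

lemma hol_fun_on_det_jacobian:
  assumes "open U" "hol_map_on H U"
  shows "hol_fun_on (\<lambda>z. det (jacobian H (at z))) U"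
  by (intro hol_fun_on_det hol_fun_on_jacobian assms)

lemma ball_subset_preimage:
  assumes "open U" "p \<in> U" "continuous_on U H" "open \<Omega>" "H p \<in> \<Omega>"
  obtains r where "r > 0" "ball p r \<subseteq> U" "H ` ball p r \<subseteq> \<Omega>"
proof -
  have "open (U \<inter> H -` \<Omega>)" using assms(1,3,4) continuous_open_preimage by blast
  then obtain r where "r > 0" "ball p r \<subseteq> U \<inter> H -` \<Omega>"
    using assms(2,5) open_contains_ball[of "U \<inter> H -` \<Omega>"] by blast
  then show thesis using that[of r] by blast
qed

text \<open>The interior \<open>Z\<close> of the zero set meets \<open>M\<close> in a relatively
  open set. It is also relatively closed: a ball about a point of \<open>M\<close> in the closure of
  \<open>Z\<close> meets \<open>Z\<close> in a nonempty open set, and the identity theorem spreads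
  the zeros over the ball.\<close>

lemma det_jacobian_zero_propagates:
  assumes "connected M" "M \<subseteq> U" "open U" "hol_map_on H U"
    and "p \<in> M" "\<epsilon> > 0" "\<And>z. z \<in> ball p \<epsilon> \<Longrightarrow> det (jacobian H (at z)) = 0"
    and "q \<in> M"
  shows "det (jacobian H (at q)) = 0"
proof -
  define Z where "Z = interior {z. det (jacobian H (at z)) = 0}"
  have "x \<in> Z" if x: "x \<in> M" "x \<in> closure Z" for x
  proof -
    obtain r where r: "r > 0" "ball x r \<subseteq> U" using assms(2,3) x(1) open_contains_ball by blast
    then obtain y where y: "y \<in> Z \<inter> ball x r"
      using x(2) by (auto simp: closure_approachable dist_commute)
    have "det (jacobian H (at z)) = 0" if "z \<in> ball x r" for z
    proof (rule hol_fun_zero_on_convex[OF open_ball convex_ball _ _ _ y _ that])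
      show "hol_fun_on (\<lambda>z. det (jacobian H (at z))) (ball x r)"
        using hol_fun_on_det_jacobian[OF assms(3,4)] r(2) by (rule hol_fun_on_subset)
      show "open (Z \<inter> ball x r)" by (simp add: Z_def open_Int)
      show "det (jacobian H (at z)) = 0" if "z \<in> Z \<inter> ball x r" for z
        using that interior_subset by (auto simp: Z_def)
    qed simp
    then show ?thesis unfolding Z_def using r(1) by (intro interiorI[of "ball x r"]) auto
  qed
  then have "M \<inter> Z = M \<inter> closure Z" using closure_subset by blast
  moreover have "openin (top_of_set M) (M \<inter> Z)" by (simp add: Z_def openin_open_Int)
  moreover have "closedin (top_of_set M) (M \<inter> closure Z)" by (simp add: closedin_closed_Int)
  ultimately have "M \<inter> Z = {} \<or> M \<inter> Z = M"
    using assms(1) unfolding connected_clopen by metis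
  moreover have "p \<in> Z"
    unfolding Z_def using assms(6,7) by (intro interiorI[of "ball p \<epsilon>"]) auto
  ultimately have "q \<in> Z" using assms(5,8) by blast
  then show ?thesis using interior_subset by (auto simp: Z_def)
qed

text \<open>Differentiating \<open>g (H z) = 0\<close>, where \<open>g\<close> is the equation of
  the Segre variety, shows that the gradient of \<open>g\<close> at \<open>H z\<close> is a nonzero
  null covector of the Jacobian.\<close>

lemma segre_image_imp_det_zero:
  fixes H :: "complex ^ 'N \<Rightarrow> complex ^ 'N"
  assumes M: "real_analytic_hypersurface M" "p \<in> M"
    and W: "open W" "p \<in> W" "hol_map_on H W"
    and S: "is_segre_variety M' (H p) S" "H ` (M \<inter> W) \<subseteq> S"
  obtains \<epsilon> where "\<epsilon> > 0" "\<And>z. z \<in> ball p \<epsilon> \<Longrightarrow> det (jacobian H (at z)) = 0"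
proof -
  obtain \<Omega> \<rho> R where \<Omega>: "H p \<in> \<Omega>" "defining_function M' \<Omega> \<rho>" and R: "complexification \<Omega> \<rho> R"
    and S_eq: "S = {z \<in> \<Omega>. R (join_vec z (conj_vec (H p))) = 0}"
    using S(1) unfolding is_segre_variety_def by blast
  have "open \<Omega>" "frechet_derivative \<rho> (at (H p)) \<noteq> (\<lambda>_. 0)"
    using \<Omega> by (auto simp: defining_function_def)
  define g where "g z = R (join_vec z (conj_vec (H p)))" for z
  have g: "hol_fun_on g \<Omega>"
    unfolding g_def by (rule complexification_slice_hol(1)[OF R \<Omega>(1)])
  obtain j where "pd (Inl j) R (join_vec (H p) (conj_vec (H p))) \<noteq> 0"
    using complexification_gradient_nonzero[OF R \<Omega>(1)] \<open>frechet_derivative \<rho> (at (H p)) \<noteq> (\<lambda>_. 0)\<close> .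
  then have j: "pd j g (H p) \<noteq> 0"
    unfolding g_def complexification_slice_hol(2)[OF R \<Omega>(1) \<Omega>(1)] .
  \<comment> \<open>Continuity of \<open>pd j g\<close> keeps the gradient of \<open>g\<close>
    nonzero near \<open>H p\<close>.\<close>
  define \<Omega>' where "\<Omega>' = \<Omega> \<inter> pd j g -` (- {0})"
  have "open \<Omega>'"
    unfolding \<Omega>'_def using \<open>open \<Omega>\<close> g
    by (intro continuous_open_preimage hol_fun_on_continuous hol_fun_on_pd) auto
  moreover have "H p \<in> \<Omega>'" using \<Omega>(1) j by (simp add: \<Omega>'_def)
  ultimately obtain r where r: "r > 0" "ball p r \<subseteq> W" "H ` ball p r \<subseteq> \<Omega>'"
    using ball_subset_preimage[OF W(1,2) hol_map_on_continuous[OF W(3)]] by blast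
  have H: "hol_map_on H (ball p r)" using W(3) r(2) by (rule hol_map_on_subset)
  have H_in: "H z \<in> \<Omega>" "pd j g (H z) \<noteq> 0" if "z \<in> ball p r" for z
  proof -
    have "H z \<in> \<Omega>'" using r(3) that by blast
    then show "H z \<in> \<Omega>" "pd j g (H z) \<noteq> 0" by (simp_all add: \<Omega>'_def)
  qed
  obtain \<epsilon> where \<epsilon>: "\<epsilon> > 0" "ball p \<epsilon> \<subseteq> ball p r" "\<And>z. z \<in> ball p \<epsilon> \<Longrightarrow> g (H z) = 0"
  proof (rule hol_fun_zero_near_hypersurface[OF M open_ball])
    show "p \<in> ball p r" using r(1) by simp
    show "hol_fun_on (\<lambda>z. g (H z)) (ball p r)"
      using g H by (rule hol_fun_on_comp) (use H_in in auto)
    show "g (H x) = 0" if "x \<in> M \<inter> ball p r" for x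
    proof -
      have "H x \<in> S" using that r(2) S(2) by blast
      then show ?thesis by (simp add: S_eq g_def)
    qed
  qed blast
  have "det (jacobian H (at z)) = 0" if z: "z \<in> ball p \<epsilon>" for z
  proof -
    have zr: "z \<in> ball p r" using z \<epsilon>(2) by blast
    have D: "((\<lambda>z. 0) has_derivative
        (\<lambda>v. \<Sum>j\<in>UNIV. (\<Sum>i\<in>UNIV. pd i g (H z) * jacobian H (at z) $ i $ j) * v $ j)) (at z)"
      by (rule has_derivative_transform_within_open[OF
            hol_fun_comp_deriv[OF g H zr H_in(1)[OF zr]] open_ball z \<epsilon>(3)])
    have "(\<Sum>i\<in>UNIV. pd i g (H z) * jacobian H (at z) $ i $ j) = 0" for j
      using pd_eqI[OF D, of j] by (simp add: pd_def)
    then have "transpose (jacobian H (at z)) *v (\<chi> i. pd i g (H z)) = 0"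
      by (simp add: vec_eq_iff matrix_vector_mult_def transpose_def mult.commute)
    moreover have "(\<chi> i. pd i g (H z)) \<noteq> 0" using H_in(2)[OF zr] by (auto simp: vec_eq_iff)
    ultimately have "det (transpose (jacobian H (at z))) = 0" by (intro kernel_imp_det_eq_0)
    then show ?thesis by (simp add: det_transpose)
  qed
  then show thesis using that \<epsilon>(1) by blast
qed

text \<open>Any \<open>z\<close> near \<open>p\<close> can be joined to \<open>p\<close> by a
  polarized line, which turns the vanishing of \<rho> on the image of \<open>H\<close> into the
  Segre equation for the pair of \<open>H z\<close> and \<open>H p\<close>.\<close>

lemma locally_flat_imp_segre_image:
  fixes H :: "complex ^ 'N \<Rightarrow> complex ^ 'N"
  assumes M': "real_analytic_hypersurface M'" and V: "open V" "p \<in> V" "H ` V \<subseteq> M'"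
    and H: "hol_map_on H V"
  obtains W S where "open W" "W \<subseteq> V" "p \<in> W" "is_segre_variety M' (H p) S" "H ` W \<subseteq> S"
proof -
  have "H p \<in> M'" using V by blast
  obtain \<Omega>0 \<rho> where "H p \<in> \<Omega>0" "defining_function M' \<Omega>0 \<rho>"
    using real_analytic_hypersurfaceE[OF M' \<open>H p \<in> M'\<close>] .
  then obtain r R where r: "r > 0" and R: "complexification (ball (H p) r) \<rho> R"
    and def: "defining_function M' (ball (H p) r) \<rho>"
    using defining_function_complexification[OF _ _ open_UNIV UNIV_I] by metis
  define \<Omega> where "\<Omega> = ball (H p) r"
  have p\<Omega>: "H p \<in> \<Omega>" using r by (simp add: \<Omega>_def)
  obtain e where e: "e > 0" "ball p e \<subseteq> V" "H ` ball p e \<subseteq> \<Omega>"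
    using ball_subset_preimage[OF V(1,2) hol_map_on_continuous[OF H] _ p\<Omega>] \<Omega>_def by blast
  define S where "S = {z \<in> \<Omega>. R (join_vec z (conj_vec (H p))) = 0}"
  have segre: "is_segre_variety M' (H p) S"
    unfolding is_segre_variety_def S_def using R def p\<Omega> \<Omega>_def by blast
  have mem: "H z \<in> S" if z: "z \<in> ball p e" for z
  proof -
    \<comment> \<open>Midpoint and direction are chosen so that the parameters \<open>\<i>\<close>
      and \<open>cnj \<i>\<close> give exactly \<open>z\<close> and \<open>p\<close>.\<close>
    define m where "m = (1/2) *\<^sub>R z + (1/2) *\<^sub>R p"
    define u where "u = (- \<i> / 2) *s (z - p)"
    have m: "m \<in> ball p e"
      unfolding m_def using z e(1) by (intro convexD[OF convex_ball]) auto
    have zu: "m + \<i> *s u = z" "m + cnj \<i> *s u = p"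
      unfolding m_def u_def vec_eq_iff vector_scaleR_component vector_add_component
        vector_smult_component vector_minus_component
      by (simp_all add: scaleR_conv_of_real field_simps)
    have "R (join_vec (H (m + \<i> *s u)) (conj_vec (H (m + cnj \<i> *s u)))) = 0"
    proof (rule polarized_line_zero[OF open_ball convex_ball hol_map_on_subset[OF H e(2)] e(3) _ m zero_less_one])
      show "complexification \<Omega> \<rho> R" using R by (simp add: \<Omega>_def)
      show "\<rho> (H (m + a *\<^sub>R u)) = 0" if "m + a *\<^sub>R u \<in> ball p e" for a
      proof -
        have "H (m + a *\<^sub>R u) \<in> M' \<inter> \<Omega>" using that e(2,3) V(3) by blast
        then show ?thesis using def unfolding \<Omega>_def defining_function_def by blast
      qed
      show "m + \<i> *s u \<in> ball p e" "m + cnj \<i> *s u \<in> ball p e"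
        unfolding zu using z e(1) by simp_all
    qed
    then show ?thesis unfolding S_def zu using e(3) z by blast
  qed
  show thesis
    by (rule that[OF open_ball e(2) _ segre]) (use e(1) in simp, use mem in blast)
qed

section \<open>Holomorphic vector fields transverse to a hypersurface\<close>

text \<open>A real linear form is twice the real part of its (1,0)-part; for the derivative of
  \<rho> the coefficients are those of \<open>wirtinger\<close>.\<close>

lemma linear_real_coordinates:
  fixes D :: "complex ^ 'k \<Rightarrow> real"
  assumes "linear D"
  shows "D v = 2 * Re (\<Sum>j\<in>UNIV. v $ j * ((of_real (D (axis j 1)) - \<i> * of_real (D (axis j \<i>))) / 2))"
proof -
  have v: "v = (\<Sum>j\<in>UNIV. Re (v $ j) *\<^sub>R axis j 1 + Im (v $ j) *\<^sub>R axis j \<i>)"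
    unfolding vec_eq_iff
  proof
    fix i
    have "(\<Sum>j\<in>UNIV. Re (v $ j) *\<^sub>R axis j 1 + Im (v $ j) *\<^sub>R axis j \<i>) $ i
        = (\<Sum>j\<in>UNIV. if j = i then Re (v $ j) *\<^sub>R 1 + Im (v $ j) *\<^sub>R \<i> else 0)"
      unfolding sum_component by (intro sum.cong) (auto simp: axis_def)
    then show "v $ i = (\<Sum>j\<in>UNIV. Re (v $ j) *\<^sub>R axis j 1 + Im (v $ j) *\<^sub>R axis j \<i>) $ i"
      by (simp add: complex_eq_iff)
  qed
  have "D v = D (\<Sum>j\<in>UNIV. Re (v $ j) *\<^sub>R axis j 1 + Im (v $ j) *\<^sub>R axis j \<i>)"
    by (rule arg_cong[OF v])
  also have "\<dots> = (\<Sum>j\<in>UNIV. Re (v $ j) * D (axis j 1) + Im (v $ j) * D (axis j \<i>))"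
    by (simp add: linear_sum[OF assms] linear_add[OF assms] linear_scale[OF assms])
  finally show ?thesis by (simp add: sum_distrib_left add_divide_distrib)
qed

text \<open>A constant complex multiple of \<open>X\<close> still lies in the kernel of the
  Jacobian, and can be chosen so that \<rho> strictly increases along it. By
  \<open>fibre_meets_zero_set\<close> each point near \<open>q\<close> then has the same image as
  some point of \<open>M\<close>.\<close>

lemma transverse_fibres_imp_image_subset:
  fixes H :: "complex ^ 'N \<Rightarrow> complex ^ 'N"
  assumes G: "open G" "q \<in> G" "q \<in> M" and M: "real_analytic_hypersurface M"
    and H: "hol_map_on H G" and X: "hol_map_on X G"
    and HX: "\<And>z. z \<in> G \<Longrightarrow> jacobian H (at z) *v X z = 0"
    and nt: "\<not> tangent_10 M q (X q)"
  obtains \<epsilon> where "\<epsilon> > 0" "H ` ball q \<epsilon> \<subseteq> H ` M"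
proof -
  obtain \<Omega> \<rho> where \<Omega>: "q \<in> \<Omega>" "defining_function M \<Omega> \<rho>"
    using real_analytic_hypersurfaceE[OF M G(3)] .
  obtain r0 R where r0: "r0 > 0" "ball q r0 \<subseteq> \<Omega> \<inter> G" and R: "complexification (ball q r0) \<rho> R"
    and def: "defining_function M (ball q r0) \<rho>"
    using defining_function_complexification[OF \<Omega>(2,1) G(1,2)] .
  define B where "B = ball q r0"
  note smooth = complexification_imp_continuous_deriv[OF R, folded B_def]
  have q: "q \<in> B" using r0(1) by (simp add: B_def)
  have BG: "B \<subseteq> G" using r0(2) by (simp add: B_def)
  define s where "s z = (\<Sum>j\<in>UNIV. X z $ j * wirtinger \<rho> j z)" for z
  \<comment> \<open>Tangency asks for some defining function, so its failure applies to the present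
    \<rho>.\<close>
  have sq: "s q \<noteq> 0"
    using nt def q unfolding s_def B_def tangent_10_def by blast
  \<comment> \<open>The factor rotates the pairing into the positive reals: at \<open>q\<close> the
    derivative of \<rho> along \<open>Y\<close> is \<open>2 * (norm (s q))\<^sup>2\<close>, so half
    of it is a lower bound nearby.\<close>
  define Y where "Y z = cnj (s q) *s X z" for z
  have X_cont: "continuous_on B X"
    using hol_map_on_continuous[OF X] BG by (rule continuous_on_subset)
  have dY: "frechet_derivative \<rho> (at z) (Y z) = 2 * Re (cnj (s q) * s z)" if "z \<in> B" for z
    using linear_real_coordinates[OF has_derivative_linear[OF smooth(3)[OF that]], of "Y z"]
    by (simp add: Y_def s_def wirtinger_def sum_distrib_left mult.assoc)
  have "continuous_on B s"
    unfolding s_def wirtinger_def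
    by (intro continuous_intros continuous_on_component X_cont smooth(2)) auto
  then have "continuous_on B (\<lambda>z. frechet_derivative \<rho> (at z) (Y z))"
    by (subst continuous_on_cong[OF refl dY]) (auto intro!: continuous_intros)
  then have "open (B \<inter> (\<lambda>z. frechet_derivative \<rho> (at z) (Y z)) -` {(norm (s q))\<^sup>2<..})"
    by (intro continuous_open_preimage) (auto simp: B_def)
  moreover have "frechet_derivative \<rho> (at q) (Y q) > (norm (s q))\<^sup>2"
  proof -
    have "cnj (s q) * s q = of_real ((norm (s q))\<^sup>2)" by (metis complex_norm_square mult.commute)
    then show ?thesis unfolding dY[OF q] using sq by simp
  qed
  ultimately obtain r where r: "r > 0"
    "cball q r \<subseteq> B \<inter> (\<lambda>z. frechet_derivative \<rho> (at z) (Y z)) -` {(norm (s q))\<^sup>2<..}"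
    using q open_contains_cball[of "B \<inter> (\<lambda>z. frechet_derivative \<rho> (at z) (Y z)) -` {(norm (s q))\<^sup>2<..}"]
    by blast
  have rB: "w \<in> B" "frechet_derivative \<rho> (at w) (Y w) \<ge> (norm (s q))\<^sup>2" if "w \<in> cball q r" for w
    using r(2) that by (auto intro: less_imp_le)
  have "continuous_on (cball q r) X"
    using X_cont by (rule continuous_on_subset) (use rB in blast)
  then obtain L where L: "\<And>w. w \<in> cball q r \<Longrightarrow> norm (X w) \<le> L"
    using compact_continuous_image[OF _ compact_cball] by (meson bounded_iff compact_imp_bounded imageI)
  have "\<exists>\<epsilon>>0. \<forall>z\<in>ball q \<epsilon>. \<exists>w\<in>cball q r. \<rho> w = 0 \<and> H w = H z"
  proof (rule fibre_meets_zero_set[OF r(1)])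
    show "(norm (s q))\<^sup>2 > 0" using sq by simp
    show "\<rho> q = 0" using def G(3) q by (auto simp: defining_function_def B_def)
    fix w assume w: "w \<in> cball q r"
    show "(\<rho> has_derivative frechet_derivative \<rho> (at w)) (at w)"
      by (rule smooth(3)[OF rB(1)[OF w]])
    have wG: "w \<in> G" using rB(1)[OF w] BG by blast
    show "(H has_derivative (\<lambda>v. jacobian H (at w) *v v)) (at w)"
      by (rule hol_map_has_derivative(1)[OF H wG])
    show "jacobian H (at w) *v Y w = 0"
      by (simp add: Y_def vector_scalar_commute HX[OF wG])
    show "(norm (s q))\<^sup>2 \<le> frechet_derivative \<rho> (at w) (Y w)" by (rule rB(2)[OF w])
    show "norm (Y w) \<le> norm (s q) * L"
      using mult_left_mono[OF L[OF w], of "norm (s q)"] by (simp add: Y_def norm_vector_scalar_mult)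
  qed
  then obtain \<epsilon> where "\<epsilon> > 0" and \<epsilon>: "\<And>z. z \<in> ball q \<epsilon> \<Longrightarrow> \<exists>w\<in>cball q r. \<rho> w = 0 \<and> H w = H z"
    by blast
  have "H ` ball q \<epsilon> \<subseteq> H ` M"
  proof
    fix y assume "y \<in> H ` ball q \<epsilon>"
    then obtain z where z: "z \<in> ball q \<epsilon>" "y = H z" by blast
    obtain w where w: "w \<in> cball q r" "\<rho> w = 0" "H w = H z" using \<epsilon>[OF z(1)] by blast
    have "M \<inter> B = {z \<in> B. \<rho> z = 0}" using def unfolding defining_function_def B_def by blast
    then have "w \<in> M" using w(2) rB(1)[OF w(1)] by blast
    then show "y \<in> H ` M" unfolding z(2) w(3)[symmetric] by (rule imageI)
  qed
  then show thesis using that \<open>\<epsilon> > 0\<close> by blast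
qed

text \<open>Cramer's rule yields a holomorphic kernel field without zeros near a point of
  \<open>M\<close>. Nondegeneracy makes it transverse somewhere, where \<open>H\<close> maps a ball
  into \<open>M'\<close>; lines from its centre carry the equation of \<open>M'\<close> to all of
  \<open>N\<close>.\<close>

lemma degenerate_imp_locally_flat:
  fixes H :: "complex ^ 'N \<Rightarrow> complex ^ 'N"
  assumes M: "real_analytic_hypersurface M" and nondeg: "holomorphically_nondegenerate M"
    and M': "real_analytic_hypersurface M'" and U: "open U" "M \<subseteq> U" and H: "hol_map_on H U"
    and HM: "H ` M \<subseteq> M'" and det0: "\<And>z. z \<in> M \<Longrightarrow> det (jacobian H (at z)) = 0"
    and p: "p \<in> M"
  obtains r where "r > 0" "ball p r \<subseteq> U" "H ` ball p r \<subseteq> M'"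
proof -
  have "H p \<in> M'" using p HM by blast
  obtain \<Omega>0 \<rho> where "H p \<in> \<Omega>0" "defining_function M' \<Omega>0 \<rho>"
    using real_analytic_hypersurfaceE[OF M' \<open>H p \<in> M'\<close>] .
  then obtain r' R where r': "r' > 0" and R: "complexification (ball (H p) r') \<rho> R"
    and def: "defining_function M' (ball (H p) r') \<rho>"
    using defining_function_complexification[OF _ _ open_UNIV UNIV_I] by metis
  define \<Omega> where "\<Omega> = ball (H p) r'"
  have "p \<in> U" using p U by blast
  have "H p \<in> \<Omega>" "open \<Omega>" using r' by (simp_all add: \<Omega>_def)
  obtain r where r: "r > 0" "ball p r \<subseteq> U" "H ` ball p r \<subseteq> \<Omega>"
    using ball_subset_preimage[OF U(1) \<open>p \<in> U\<close> hol_map_on_continuous[OF H] \<open>open \<Omega>\<close> \<open>H p \<in> \<Omega>\<close>] .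
  define N where "N = ball p r"
  have N: "open N" "convex N" "p \<in> N" "N \<subseteq> U" "H ` N \<subseteq> \<Omega>" using r by (auto simp: N_def)
  have HN: "hol_map_on H N" using H N(4) by (rule hol_map_on_subset)
  \<comment> \<open>Vanishing on \<open>M\<close> gives vanishing near \<open>p\<close>, and
    convexity of \<open>N\<close> extends it to all of \<open>N\<close>.\<close>
  have zero_N: "g z = 0" if g: "hol_fun_on g N" "\<And>x. x \<in> M \<inter> N \<Longrightarrow> g x = 0" and z: "z \<in> N"
    for g :: "complex ^ 'N \<Rightarrow> complex" and z
  proof -
    obtain \<epsilon> where "\<epsilon> > 0" "ball p \<epsilon> \<subseteq> N" "\<And>z. z \<in> ball p \<epsilon> \<Longrightarrow> g z = 0"
      using hol_fun_zero_near_hypersurface[OF M p N(1,3) g] by blast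
    then show ?thesis
      using hol_fun_zero_on_convex[OF N(1,2) g(1) open_ball _ _ _ z, of p \<epsilon> p] by simp
  qed
  have "det (jacobian H (at z)) = 0" if "z \<in> N" for z
    by (rule zero_N[OF hol_fun_on_det_jacobian[OF N(1) HN] _ that]) (use det0 in blast)
  then obtain B u z0 where "z0 \<in> N" and B: "det (jacobian H (at z0) + B) \<noteq> 0"
    and u: "\<And>z x. z \<in> N \<Longrightarrow> det (jacobian H (at z) + B) \<noteq> 0 \<Longrightarrow> (jacobian H (at z) + B) *v x = u \<Longrightarrow>
        jacobian H (at z) *v x = 0 \<and> x \<noteq> 0"
    using det_zero_perturbation[of N "\<lambda>z. jacobian H (at z)"] N(3) by (metis empty_iff)
  define C where "C z = jacobian H (at z) + B" for z
  have C_hol: "hol_fun_on (\<lambda>z. C z $ i $ j) N" for i j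
    unfolding C_def vector_add_component
    by (intro hol_fun_on_add hol_fun_on_jacobian N(1) HN hol_fun_on_const)
  have detC: "hol_fun_on (\<lambda>z. det (C z)) N" by (intro hol_fun_on_det C_hol)
  \<comment> \<open>Otherwise \<open>det (C z)\<close> would vanish on \<open>M\<close> within
    \<open>N\<close>, hence at \<open>z0\<close>.\<close>
  obtain q where q: "q \<in> M \<inter> N" "det (C q) \<noteq> 0"
    using zero_N[OF detC _ \<open>z0 \<in> N\<close>] B by (auto simp: C_def)
  define G where "G = N \<inter> (\<lambda>z. det (C z)) -` (- {0})"
  have "open G"
    unfolding G_def using hol_fun_on_continuous[OF detC] N(1) by (intro continuous_open_preimage) auto
  have GN: "G \<subseteq> N" "\<And>z. z \<in> G \<Longrightarrow> det (C z) \<noteq> 0" by (auto simp: G_def)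
  \<comment> \<open>The Cramer numerators, that is, \<open>det (C z)\<close> times the solution of
    \<open>C z *v x = u\<close>: free of division, hence holomorphic.\<close>
  define X where "X z = (\<chi> k. det (\<chi> i j. if j = k then u $ i else C z $ i $ j))" for z
  have X_hol: "hol_map_on X G"
    unfolding hol_map_on_def X_def
  proof
    fix k
    have "hol_fun_on (\<lambda>z. (\<chi> i j. if j = k then u $ i else C z $ i $ j) $ i $ j) G" for i j
      using hol_fun_on_subset[OF C_hol GN(1)] by (cases "j = k") (auto intro: hol_fun_on_const)
    then show "hol_fun_on (\<lambda>z. (\<chi> k. det (\<chi> i j. if j = k then u $ i else C z $ i $ j)) $ k) G"
      by (simp only: vec_lambda_beta) (rule hol_fun_on_det, simp)
  qed
  have X: "jacobian H (at z) *v X z = 0" "X z \<noteq> 0" if "z \<in> G" for z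
  proof -
    have d: "det (C z) \<noteq> 0" and zN: "z \<in> N" using that GN by auto
    obtain x where x: "C z *v x = u" using cramer[OF d] by blast
    have "X z = det (C z) *s x"
      unfolding X_def x[symmetric] cramer_lemma by (simp add: vec_eq_iff mult.commute)
    moreover have "jacobian H (at z) *v x = 0" "x \<noteq> 0"
      using u[OF zN] d x by (auto simp: C_def)
    ultimately show "jacobian H (at z) *v X z = 0" "X z \<noteq> 0"
      using d by (auto simp: vector_scalar_commute vec_eq_iff[of x] vec_eq_iff[of "_ *s _"])
  qed
  have "q \<in> G" using q by (simp add: G_def)
  obtain q1 where q1: "q1 \<in> M" "q1 \<in> G" "\<not> tangent_10 M q1 (X q1)"
  proof -
    have "\<forall>N'. open N' \<and> q \<in> N' \<longrightarrow> (\<exists>z\<in>G \<inter> N'. X z \<noteq> 0)" using X(2) \<open>q \<in> G\<close> by blast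
    then have "\<not> (\<forall>q1\<in>M \<inter> G. tangent_10 M q1 (X q1))"
      using nondeg q(1) \<open>open G\<close> \<open>q \<in> G\<close> X_hol unfolding holomorphically_nondegenerate_def by blast
    then show thesis using that by blast
  qed
  obtain \<epsilon> where \<epsilon>: "\<epsilon> > 0" "H ` ball q1 \<epsilon> \<subseteq> H ` M"
    using transverse_fibres_imp_image_subset[OF \<open>open G\<close> q1(2,1) M
        hol_map_on_subset[OF HN GN(1)] X_hol X(1) q1(3)] by blast
  have q1N: "q1 \<in> N" using q1(2) GN by blast
  have "H z \<in> M'" if z: "z \<in> N" for z
  proof -
    \<comment> \<open>For \<open>a < d\<close> the point \<open>q1 + a *\<^sub>R (z - q1)\<close>
      lies in \<open>ball q1 \<epsilon>\<close>; the summand 1 covers \<open>z = q1\<close>.\<close>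
    define d where "d = \<epsilon> / (norm (z - q1) + 1)"
    have npos: "norm (z - q1) + 1 > 0" using norm_ge_zero[of "z - q1"] by linarith
    have "R (join_vec (H (q1 + 1 *s (z - q1))) (conj_vec (H (q1 + cnj 1 *s (z - q1))))) = 0"
    proof (rule polarized_line_zero[OF N(1,2) HN N(5) _ q1N])
      show "complexification \<Omega> \<rho> R" using R by (simp add: \<Omega>_def)
      show "d > 0" using \<epsilon>(1) npos by (simp add: d_def)
      fix a assume a: "0 < a" "a < d" "q1 + a *\<^sub>R (z - q1) \<in> N"
      have "a * norm (z - q1) \<le> a * (norm (z - q1) + 1)" using a(1) by (intro mult_left_mono) auto
      also have "\<dots> < \<epsilon>" using a(2) npos by (simp add: d_def field_simps)
      finally have "q1 + a *\<^sub>R (z - q1) \<in> ball q1 \<epsilon>" using a(1) by (simp add: dist_norm)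
      then have "H (q1 + a *\<^sub>R (z - q1)) \<in> M' \<inter> \<Omega>" using \<epsilon>(2) HM N(5) a(3) by blast
      then show "\<rho> (H (q1 + a *\<^sub>R (z - q1))) = 0"
        using def unfolding \<Omega>_def defining_function_def by blast
    qed (use z in simp_all)
    then have "R (join_vec (H z) (conj_vec (H z))) = 0" by simp
    moreover have "H z \<in> \<Omega>" using N(5) z by blast
    ultimately have "\<rho> (H z) = 0"
      using R unfolding complexification_def \<Omega>_def by (metis of_real_eq_0_iff)
    then show ?thesis using def \<open>H z \<in> \<Omega>\<close> unfolding \<Omega>_def defining_function_def by blast
  qed
  then show thesis using that[of r] r N_def by blast
qed

theorem corollary5p2:
  fixes M M' U :: "(complex ^ 'N) set" and H :: "complex ^ 'N \<Rightarrow> complex ^ 'N" and n :: nat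
  assumes "CARD('N) = n + 1"
    and "real_analytic_hypersurface M" "connected M"
    and "real_analytic_hypersurface M'" "connected M'"
    and "open U" "M \<subseteq> U"
    and "holomorphically_nondegenerate M"
    and "hol_map_on H U"
    and "H ` M \<subseteq> M'"
  shows
    "((\<exists>V. open V \<and> V \<subseteq> U \<and> M \<subseteq> V \<and> H ` V \<subseteq> M') \<longleftrightarrow>
      (\<exists>p\<in>M. \<exists>W. open W \<and> W \<subseteq> U \<and> p \<in> W \<and>
         (\<exists>S. is_segre_variety M' (H p) S \<and> H ` (M \<inter> W) \<subseteq> S)))
     \<and>
     ((\<exists>p\<in>M. \<exists>W. open W \<and> W \<subseteq> U \<and> p \<in> W \<and>
         (\<exists>S. is_segre_variety M' (H p) S \<and> H ` (M \<inter> W) \<subseteq> S)) \<longleftrightarrow>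
      (\<forall>p\<in>M. hol_rank H p \<le> n))"
    (is "(?i \<longleftrightarrow> ?iv) \<and> (?iv \<longleftrightarrow> ?v)")
proof -
  \<comment> \<open>As the dimension is \<open>n + 1\<close>, rank at most \<open>n\<close> means a
    singular Jacobian.\<close>
  have rank: "hol_rank H p \<le> n \<longleftrightarrow> det (jacobian H (at p)) = 0" for p
    using rank_less_iff_det_eq_0[of "jacobian H (at p)"] assms(1) by (auto simp: hol_rank_def)
  have "?i \<Longrightarrow> ?iv"
  proof -
    assume ?i
    then obtain V where V: "open V" "V \<subseteq> U" "M \<subseteq> V" "H ` V \<subseteq> M'" by blast
    \<comment> \<open>Hypersurfaces are nonempty by definition.\<close>
    obtain p where p: "p \<in> M" using assms(2) by (auto simp: real_analytic_hypersurface_def)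
    then have "p \<in> V" using V(3) by blast
    obtain W S where "open W" "W \<subseteq> V" "p \<in> W" "is_segre_variety M' (H p) S" "H ` W \<subseteq> S"
      using locally_flat_imp_segre_image[OF assms(4) V(1) \<open>p \<in> V\<close> V(4) hol_map_on_subset[OF assms(9) V(2)]] .
    then show ?iv using p V(2) by blast
  qed
  moreover have "?iv \<Longrightarrow> ?v"
  proof -
    assume ?iv
    then obtain p W S where p: "p \<in> M" and W: "open W" "W \<subseteq> U" "p \<in> W"
      and S: "is_segre_variety M' (H p) S" "H ` (M \<inter> W) \<subseteq> S" by blast
    obtain \<epsilon> where "\<epsilon> > 0" "\<And>z. z \<in> ball p \<epsilon> \<Longrightarrow> det (jacobian H (at z)) = 0"
      using segre_image_imp_det_zero[OF assms(2) p W(1,3) hol_map_on_subset[OF assms(9) W(2)] S] by blast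
    then show ?v
      unfolding rank using det_jacobian_zero_propagates[OF assms(3,7,6,9) p] by blast
  qed
  moreover have "?v \<Longrightarrow> ?i"
  proof -
    assume ?v
    then have det0: "\<And>z. z \<in> M \<Longrightarrow> det (jacobian H (at z)) = 0" by (simp add: rank)
    have "\<exists>r>0. ball p r \<subseteq> U \<and> H ` ball p r \<subseteq> M'" if "p \<in> M" for p
      using degenerate_imp_locally_flat[OF assms(2,8,4,6,7,9,10) det0 that] by metis
    then obtain r where r: "\<And>p. p \<in> M \<Longrightarrow> r p > 0 \<and> ball p (r p) \<subseteq> U \<and> H ` ball p (r p) \<subseteq> M'"
      by metis
    \<comment> \<open>The local statement holds at every point of \<open>M\<close>, so the union of
      the balls serves as \<open>V\<close>.\<close>
    show ?i
    proof (intro exI conjI)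
      show "open (\<Union>p\<in>M. ball p (r p))" by blast
      show "(\<Union>p\<in>M. ball p (r p)) \<subseteq> U" "H ` (\<Union>p\<in>M. ball p (r p)) \<subseteq> M'" using r by blast+
      show "M \<subseteq> (\<Union>p\<in>M. ball p (r p))" using r by force
    qed
  qed
  ultimately show ?thesis by blast
qed

end
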